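(* Let $0<\alpha<1$, $\beta>0$, $y(x)=x^\beta$, and let $t>0$ be fixed. For integers $n\ge2$ let $h=t/n$ and $y_k=y(kh)$. Then, as $n\to\infty$ (with $nh=t$), $$\frac{1}{\Gamma(-\alpha)h^\alpha}\left(\sum_{k=1}^{n-1}\frac{y_{n-k}}{k^{1+\alpha}}-\zeta(1+\alpha)y_n+\zeta(\alpha)y'_n h\right)=y_n^{(\alpha)}+\frac{\zeta(-\beta)}{\Gamma(-\alpha)t^{1+\alpha}}h^{1+\beta}+O\left(h^{2-\alpha}\right).$$
   Context: $\zeta$ is the Riemann zeta function (analytically continued). $y_n=y(t)$, $y'_n=y'(t)=\beta t^{\beta-1}$, and $y_n^{(\alpha)}=y^{(\alpha)}(t)$ is the Caputo derivative $y^{(\alpha)}(t)=\frac{1}{\Gamma(1-\alpha)}\int_0^t \frac{y'(x)}{(t-x)^\alpha}\,dx$, which for $y(x)=x^\beta$ equals $\frac{\Gamma(1+\beta)}{\Gamma(1+\beta-\alpha)}t^{\beta-\alpha}$. *)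

theory Defs
  imports
    "HOL-Complex_Analysis.Complex_Analysis"
    "HOL-Library.Landau_Symbols"
begin

definition zeta_continuation :: "(complex \<Rightarrow> complex) \<Rightarrow> bool" where
  "zeta_continuation f \<longleftrightarrow>
     f holomorphic_on (- {1}) \<and>
     (\<forall>s. Re s > 1 \<longrightarrow> (\<lambda>n. 1 / of_nat (Suc n) powr s) sums f s)"

text \<open>Two such continuations agree away from the pole at 1 and are real at the real points
  other than 1, so the choice below only affects the value at the pole, and taking real parts
  in \<open>zeta_real\<close> loses nothing.\<close>

lemma zeta_continuation_unique:
  assumes f: "zeta_continuation f" and g: "zeta_continuation g" and s: "s \<noteq> 1"
  shows "f s = g s"
proof (rule analytic_continuation_open[of "{s. Re s > 1}" "- {1}" f g s])
  show "open {s. Re s > 1}" by (rule open_halfspace_Re_gt)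
  show "{s. Re s > 1} \<noteq> {}" proof -
    have "(2 :: complex) \<in> {s. Re s > 1}" by simp
    then show ?thesis by blast
  qed
  show "connected (- {1 :: complex})" by (rule connected_punctured_universe) simp
  show "f z = g z" if "z \<in> {s. Re s > 1}" for z
    using that f g unfolding zeta_continuation_def by (auto intro: sums_unique2)
qed (use f g s in \<open>auto simp: zeta_continuation_def\<close>)

lemma zeta_continuation_cnj:
  assumes f: "zeta_continuation f"
  shows "zeta_continuation (cnj \<circ> f \<circ> cnj)"
  unfolding zeta_continuation_def
proof (intro conjI allI impI)
  have "cnj ` (- {1}) = - {1}" 
    by (auto simp: image_iff) (metis ComplI complex_cnj_cnj complex_cnj_one singletonD)
  then show "(cnj \<circ> f \<circ> cnj) holomorphic_on - {1}"
    using f by (intro holomorphic_on_compose_cnj_cnj) (auto simp: zeta_continuation_def)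
next
  fix s :: complex assume "Re s > 1"
  then have "(\<lambda>n. 1 / of_nat (Suc n) powr cnj s) sums f (cnj s)"
    using f by (simp add: zeta_continuation_def)
  then have "(\<lambda>n. cnj (1 / of_nat (Suc n) powr cnj s)) sums cnj (f (cnj s))"
    by (subst sums_cnj)
  moreover have "cnj (1 / of_nat (Suc n) powr cnj s) = 1 / of_nat (Suc n) powr s" for n
    by (subst complex_cnj_divide, subst cnj_powr)
       (auto simp: complex_nonneg_Reals_iff simp del: of_nat_Suc)
  ultimately show "(\<lambda>n. 1 / of_nat (Suc n) powr s) sums (cnj \<circ> f \<circ> cnj) s"
    by simp
qed

lemma zeta_continuation_real:
  assumes "zeta_continuation f" "x \<noteq> 1"
  shows "f (of_real x) \<in> \<real>"
  using zeta_continuation_unique[OF assms(1) zeta_continuation_cnj[OF assms(1)], of "of_real x"]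
    assms(2) by (metis Reals_cnj_iff comp_apply complex_cnj_complex_of_real of_real_eq_1_iff)

definition riemann_zeta :: "complex \<Rightarrow> complex" where
  "riemann_zeta = (SOME f. zeta_continuation f)"

definition zeta_real :: "real \<Rightarrow> real" where
  "zeta_real x = Re (riemann_zeta (of_real x))"

text \<open>The integrands may take junk values at the endpoints 0 and \<open>t\<close>; this does not affect
  the integral.\<close>

definition caputo_deriv :: "real \<Rightarrow> (real \<Rightarrow> real) \<Rightarrow> real \<Rightarrow> real" where
  "caputo_deriv \<alpha> y t =
     1 / Gamma (1 - \<alpha>) * integral {0..t} (\<lambda>x. deriv y x / (t - x) powr \<alpha>)"

end

theory Submission
  imports Defs
begin

text \<open>
  After rescaling, the sum is a Riemann sum of \<open>(1 - x)\<^sup>\<beta> x\<^sup>-\<^sup>1\<^sup>-\<^sup>\<alpha>\<close> with nodes \<open>k / n\<close>. The singular terms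
  \<open>x\<^sup>-\<^sup>1\<^sup>-\<^sup>\<alpha> - \<beta> x\<^sup>-\<^sup>\<alpha>\<close> at \<open>0\<close> and, for small \<open>\<beta>\<close>, the term \<open>(1 - x)\<^sup>\<beta>\<close> at \<open>1\<close> are split off. Their sums are
  partial sums of \<open>\<Sum> k\<^sup>-\<^sup>s\<close>, whose constant terms are \<open>\<zeta>(1 + \<alpha>)\<close>, \<open>\<zeta>(\<alpha>)\<close> and \<open>\<zeta>(-\<beta>)\<close>. The second derivative
  of the remainder is \<open>O(x\<^sup>-\<^sup>1\<^sup>-\<^sup>\<alpha> + (1 - x)\<^sup>-\<^sup>1\<^sup>-\<^sup>\<alpha>)\<close>, so comparison with an explicit convex function bounds its
  trapezoidal error by \<open>O(n\<^sup>\<alpha>\<^sup>-\<^sup>1)\<close>. Its integral, a Beta value after one integration by parts, gives the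
  Caputo derivative.

  The continuation of \<open>\<zeta>\<close> is obtained strip by strip: Taylor expansion of
  \<open>(n + 1)\<^sup>1\<^sup>-\<^sup>s - n\<^sup>1\<^sup>-\<^sup>s\<close> and telescoping express \<open>(s - 1) \<zeta>(s)\<close> through \<open>\<zeta>(s + 1), \<zeta>(s + 2), \<dots>\<close> and a series
  converging further to the left.
\<close>

section \<open>Analytic continuation of the zeta function\<close>

text \<open>Weierstrass M-test: the exponent \<open>a - 1 - Re s\<close> is below -1 exactly when
  \<open>Re s > a\<close>, and uniformly so on closed discs inside the half plane. \<open>C\<close>
  may depend on \<open>R\<close> because the later series have coefficients polynomial in
  \<open>s\<close>.\<close>

lemma half_plane_series:
  fixes f :: "nat \<Rightarrow> complex \<Rightarrow> complex"
  assumes hol: "\<And>n. f n holomorphic_on {s. Re s > a}"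
    and bound: "\<And>R. \<exists>C. \<forall>n s. norm s \<le> R \<longrightarrow> Re s > a \<longrightarrow>
                  norm (f n s) \<le> C * real (Suc n) powr (a - 1 - Re s)"
  shows half_plane_series_summable: "Re s > a \<Longrightarrow> summable (\<lambda>n. f n s)"
    and half_plane_series_holomorphic: "(\<lambda>s. \<Sum>n. f n s) holomorphic_on {s. Re s > a}"
proof -
  have summ: "summable (\<lambda>n. C * real (Suc n) powr (- 1 - e))" if "e > 0" for C e :: real
    using that by (intro summable_mult) (subst summable_Suc_iff, simp add: summable_real_powr_iff)
  show "summable (\<lambda>n. f n s)" if s: "Re s > a" for s
  proof -
    obtain C where C: "\<And>n z. norm z \<le> norm s \<Longrightarrow> Re z > a \<Longrightarrow>
        norm (f n z) \<le> C * real (Suc n) powr (a - 1 - Re z)"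
      using bound by meson
    show ?thesis
      by (rule summable_comparison_test'[OF summ[of "Re s - a" C], of 0])
         (use C[of s] s in \<open>simp_all add: algebra_simps\<close>)
  qed
  show "(\<lambda>s. \<Sum>n. f n s) holomorphic_on {s. Re s > a}"
  proof (rule holomorphic_uniform_sequence)
    show "open {s. Re s > a}" by (rule open_halfspace_Re_gt)
    show "(\<lambda>s. \<Sum>i<n. f i s) holomorphic_on {s. Re s > a}" for n
      by (intro holomorphic_on_sum hol)
    fix x assume "x \<in> {s. Re s > a}"
    \<comment> \<open>Half the distance from \<open>x\<close> to the boundary line, so that on the
      disc the exponent is at most \<open>- 1 - d\<close>.\<close>
    define d where "d = (Re x - a) / 2"
    have d: "d > 0" using \<open>x \<in> _\<close> by (simp add: d_def)
    have Re: "Re z \<ge> a + d" if "z \<in> cball x d" for z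
      using that abs_Re_le_cmod[of "x - z"] by (simp add: dist_norm d_def field_simps)
    have nz: "norm z \<le> norm x + d" if "z \<in> cball x d" for z
      using that norm_triangle_ineq2[of z x] by (simp add: dist_norm norm_minus_commute)
    obtain C where C: "\<And>n z. norm z \<le> norm x + d \<Longrightarrow> Re z > a \<Longrightarrow>
        norm (f n z) \<le> C * real (Suc n) powr (a - 1 - Re z)"
      using bound by meson
    have "norm (f n z) \<le> \<bar>C\<bar> * real (Suc n) powr (- 1 - d)" if z: "z \<in> cball x d" for n z
    proof -
      have "norm (f n z) \<le> C * real (Suc n) powr (a - 1 - Re z)"
        using C[of z n] nz[OF z] Re[OF z] d by simp
      also have "\<dots> \<le> \<bar>C\<bar> * real (Suc n) powr (- 1 - d)"
        using Re[OF z] by (intro mult_mono powr_mono) auto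
      finally show ?thesis .
    qed
    then have "uniform_limit (cball x d) (\<lambda>n s. \<Sum>i<n. f i s) (\<lambda>s. \<Sum>n. f n s) sequentially"
      by (rule Weierstrass_m_test) (use summ[OF d] in auto)
    with d Re show "\<exists>d>0. cball x d \<subseteq> {s. Re s > a} \<and>
        uniform_limit (cball x d) (\<lambda>n s. \<Sum>i<n. f i s) (\<lambda>s. \<Sum>n. f n s) sequentially"
      by (intro exI[of _ d]) force
  qed
qed

lemma summable_zeta_complex:
  assumes "Re s > 1"
  shows "summable (\<lambda>n. of_nat (Suc n) powr (- s))"
proof (rule summable_norm_cancel)
  have "norm (of_nat (Suc n) powr (- s)) = real (Suc n) powr (- Re s)" for n
    by (subst norm_powr_real_powr) (auto simp del: of_nat_Suc)
  then show "summable (\<lambda>n. norm (of_nat (Suc n) powr (- s)))"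
    using assms by (simp add: summable_Suc_iff[of "\<lambda>n. real n powr (- Re s)"] summable_real_powr_iff
        del: of_nat_Suc)
qed

lemma powr_nat_tendsto_0:
  fixes s :: complex
  assumes "Re s < 0"
  shows "(\<lambda>n. of_nat (Suc n) powr s) \<longlonglongrightarrow> 0"
proof (subst tendsto_norm_zero_iff[symmetric])
  have "norm (of_nat (Suc n) powr s) = real (Suc n) powr Re s" for n
    by (subst norm_powr_real_powr) (auto simp del: of_nat_Suc)
  moreover have "(\<lambda>n. real (Suc n) powr Re s) \<longlonglongrightarrow> 0"
    using assms by (intro LIMSEQ_Suc tendsto_neg_powr filterlim_real_sequentially) auto
  ultimately show "(\<lambda>n. norm (of_nat (Suc n) powr s)) \<longlonglongrightarrow> 0" by simp
qed

text \<open>Order-\<open>K + 1\<close> Taylor remainder at \<open>0\<close> of \<open>u \<mapsto> (n + 1 + u)\<^sup>1\<^sup>-\<^sup>s\<close>, evaluated at \<open>u = 1\<close>.\<close>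

definition zeta_taylor_rem :: "nat \<Rightarrow> nat \<Rightarrow> complex \<Rightarrow> complex" where
  "zeta_taylor_rem K n s = of_nat (n + 2) powr (1 - s) -
     (\<Sum>k\<le>Suc K. ((1 - s) gchoose k) * of_nat (Suc n) powr (1 - s - of_nat k))"

lemma zeta_taylor_rem_holomorphic: "zeta_taylor_rem K n holomorphic_on A"
  unfolding zeta_taylor_rem_def[abs_def] gbinomial_prod_rev
  by (intro holomorphic_intros) auto

lemma has_field_derivative_shifted_powr:
  fixes x z r :: complex
  assumes "x + z \<notin> \<real>\<^sub>\<le>\<^sub>0"
  shows "((\<lambda>z. (x + z) powr r) has_field_derivative r * (x + z) powr (r - 1)) (at z within A)"
proof (rule has_field_derivative_at_within)
  show "((\<lambda>z. (x + z) powr r) has_field_derivative r * (x + z) powr (r - 1)) (at z)"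
    using has_field_derivative_powr[OF assms, of r]
      DERIV_shift[of "\<lambda>z. z powr r" "r * (x + z) powr (r - 1)" z x]
    by (simp add: add.commute)
qed

text \<open>Complex Taylor bound along the segment from 0 to 1. The derivative of order
  \<open>K + 2\<close> is a binomial coefficient, bounded on the disc by compactness, times a power
  with negative exponent, hence largest at \<open>u = 0\<close>. The rate is the one
  \<open>half_plane_series\<close> asks for with \<open>a = - K\<close>.\<close>

lemma zeta_taylor_rem_bound:
  "\<exists>C. \<forall>n s. norm s \<le> R \<longrightarrow> Re s > - real K \<longrightarrow>
     norm (zeta_taylor_rem K n s) \<le> C * real (Suc n) powr (- real K - 1 - Re s)"
proof -
  have "continuous_on (cball (0::complex) R) (\<lambda>s. (1 - s) gchoose k)" for k
    unfolding gbinomial_prod_rev by (intro continuous_intros) auto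
  then have "bounded ((\<lambda>s. (1 - s) gchoose (K + 2)) ` cball (0::complex) R)"
    by (intro compact_imp_bounded compact_continuous_image) auto
  then obtain B where "\<forall>x\<in>(\<lambda>s. (1 - s) gchoose (K + 2)) ` cball (0::complex) R. norm x \<le> B"
    unfolding bounded_iff by blast
  then have B: "norm ((1 - s) gchoose (K + 2)) \<le> B" if "norm s \<le> R" for s :: complex
    using that by simp
  show ?thesis
  \<comment> \<open>\<open>complex_Taylor\<close> of order \<open>Suc K\<close> divides by
    \<open>fact (Suc K)\<close> only, so a factor \<open>K + 2\<close> survives.\<close>
  proof (intro exI[of _ "fact (K + 2) * B / fact (Suc K)"] allI impI)
    fix n s assume s: "norm (s::complex) \<le> R" "Re s > - real K"
    define N where "N = real (Suc n)"
    have N: "N \<ge> 1" by (simp add: N_def)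
    \<comment> \<open>\<open>f i\<close> is the \<open>i\<close>-th derivative of
      \<open>u \<mapsto> (N + u) powr (1 - s)\<close>, with the falling factorial written as
      \<open>fact i\<close> times a binomial coefficient.\<close>
    define f where "f = (\<lambda>i u. fact i * ((1 - s) gchoose i) * (of_real N + u) powr (1 - s - of_nat i))"
    have seg: "\<exists>v. u = of_real v \<and> 0 \<le> v \<and> v \<le> 1" if "u \<in> closed_segment 0 (1::complex)" for u
      using that by (auto simp: in_segment scaleR_conv_of_real)
    have "norm (f 0 1 - (\<Sum>i\<le>Suc K. f i 0 * (1 - 0) ^ i / fact i))
       \<le> fact (K + 2) * (B * N powr (- real K - 1 - Re s)) * norm (1 - 0 :: complex) ^ Suc (Suc K) / fact (Suc K)"
    proof (rule complex_Taylor[of "closed_segment 0 1"])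
      fix i :: nat and u :: complex
      assume "u \<in> closed_segment 0 1"
      then obtain v where v: "u = of_real v" "0 \<le> v" "v \<le> 1" using seg by blast
      have "of_real N + u = of_real (N + v)" by (simp add: v)
      then have nn: "of_real N + u \<notin> \<real>\<^sub>\<le>\<^sub>0"
        using N v by (auto simp only: complex_nonpos_Reals_iff Re_complex_of_real)
      have c: "fact i * ((1 - s) gchoose i) * (1 - s - of_nat i) = fact (Suc i) * ((1 - s) gchoose Suc i)"
        unfolding gbinomial_mult_fact by simp
      show "(f i has_field_derivative f (Suc i) u) (at u within closed_segment 0 1)"
        unfolding f_def c[symmetric]
        by (rule DERIV_cong[OF DERIV_cmult[OF has_field_derivative_shifted_powr[OF nn]]])
           (simp add: algebra_simps)
    next
      fix u :: complex
      assume "u \<in> closed_segment 0 1"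
      then obtain v where v: "u = of_real v" "0 \<le> v" "v \<le> 1" using seg by blast
      have "norm (f (Suc (Suc K)) u) =
          fact (K + 2) * (norm ((1 - s) gchoose (K + 2)) * norm (of_real (N + v) powr (1 - s - of_nat (K + 2))))"
        unfolding f_def v by (simp add: norm_mult del: fact_Suc)
      also have "norm (of_real (N + v) powr (1 - s - of_nat (K + 2))) = (N + v) powr (- real K - 1 - Re s)"
        using N v by (subst norm_powr_real_powr) (auto intro!: arg_cong2[where f = "(powr)"])
      also have "fact (K + 2) * (norm ((1 - s) gchoose (K + 2)) * \<dots>)
          \<le> fact (K + 2) * (B * N powr (- real K - 1 - Re s))"
        using B[OF s(1)] N v s(2)
        by (intro mult_left_mono mult_mono powr_mono2') (auto intro: order_trans[OF norm_ge_zero B[OF s(1)]])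
      finally show "norm (f (Suc (Suc K)) u) \<le> fact (K + 2) * (B * N powr (- real K - 1 - Re s))" .
    qed auto
    also have "f 0 1 - (\<Sum>i\<le>Suc K. f i 0 * (1 - 0) ^ i / fact i) = zeta_taylor_rem K n s"
      by (simp add: f_def zeta_taylor_rem_def N_def add_ac del: sum.atMost_Suc)
    finally show "norm (zeta_taylor_rem K n s)
        \<le> fact (K + 2) * B / fact (Suc K) * real (Suc n) powr (- real K - 1 - Re s)"
      by (simp add: N_def mult.assoc)
  qed
qed

text \<open>Summing the Taylor expansions over \<open>n\<close>, the differences of consecutive
  powers telescope to -1, while the term of order \<open>k + 1\<close> contributes a multiple of
  \<open>Z (s + k)\<close>. The term with \<open>k = 0\<close> has coefficient \<open>1 - s\<close>
  and is moved to the left.\<close>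

lemma zeta_shift_recurrence:
  assumes s: "Re s > 1"
  defines "Z \<equiv> \<lambda>s. \<Sum>n. of_nat (Suc n) powr (- s) :: complex"
  shows "(s - 1) * Z s = 1 + (\<Sum>k=1..K. ((1 - s) gchoose Suc k) * Z (s + of_nat k))
           + (\<Sum>n. zeta_taylor_rem K n s)"
proof -
  have Z: "(\<lambda>n. of_nat (Suc n) powr (- s)) sums Z s" if "Re s > 1" for s
    unfolding Z_def by (intro summable_sums summable_zeta_complex that)
  have rem: "(\<lambda>n. zeta_taylor_rem K n s) sums (\<Sum>n. zeta_taylor_rem K n s)"
    by (intro summable_sums half_plane_series_summable[of _ "- real K"] zeta_taylor_rem_holomorphic
          zeta_taylor_rem_bound) (use s in auto)
  have tel: "(\<lambda>n. of_nat (n + 2) powr (1 - s) - of_nat (Suc n) powr (1 - s)) sums (- 1 :: complex)"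
    using telescope_sums[OF powr_nat_tendsto_0[of "1 - s"]] s by simp
  have "(\<lambda>n. (of_nat (n + 2) powr (1 - s) - of_nat (Suc n) powr (1 - s)) - 
           (\<Sum>k\<le>K. ((1 - s) gchoose Suc k) * of_nat (Suc n) powr (- (s + of_nat k))))
        sums (- 1 - (\<Sum>k\<le>K. ((1 - s) gchoose Suc k) * Z (s + of_nat k)))"
    by (intro sums_diff tel sums_sum sums_mult Z) (use s in auto)
  also have "(\<lambda>n. (of_nat (n + 2) powr (1 - s) - of_nat (Suc n) powr (1 - s)) - 
           (\<Sum>k\<le>K. ((1 - s) gchoose Suc k) * of_nat (Suc n) powr (- (s + of_nat k))))
        = (\<lambda>n. zeta_taylor_rem K n s)"
    unfolding zeta_taylor_rem_def by (subst sum.atMost_Suc_shift) (simp add: algebra_simps)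
  finally have "(\<Sum>n. zeta_taylor_rem K n s) = - 1 - (\<Sum>k\<le>K. ((1 - s) gchoose Suc k) * Z (s + of_nat k))"
    using rem by (rule sums_unique2[symmetric])
  also have "(\<Sum>k\<le>K. ((1 - s) gchoose Suc k) * Z (s + of_nat k))
      = (1 - s) * Z s + (\<Sum>k=1..K. ((1 - s) gchoose Suc k) * Z (s + of_nat k))"
    by (simp add: atMost_atLeast0 sum.atLeast_Suc_atMost)
  finally show ?thesis by (simp add: algebra_simps)
qed

text \<open>The factor \<open>1 - s - k\<close> contained in \<open>(1 - s) gchoose Suc k\<close> cancels the pole of \<open>\<zeta>(s + k)\<close>,
  so the recurrence is between values of the entire function \<open>(s - 1) \<zeta>(s)\<close>.\<close>

lemma zeta_continuation_half_plane:
  "\<exists>F. F holomorphic_on {s. Re s > 1 - real m} \<and>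
       (\<forall>s. Re s > 1 \<longrightarrow> F s = (s - 1) * (\<Sum>n. of_nat (Suc n) powr (- s)))"
proof (induction m)
  case 0
  have "(\<lambda>s. \<Sum>n. of_nat (Suc n) powr (- s) :: complex) holomorphic_on {s. Re s > 1}"
  proof (rule half_plane_series_holomorphic)
    show "(\<lambda>s. of_nat (Suc n) powr (- s)) holomorphic_on {s. Re s > 1}" for n
      by (auto intro!: holomorphic_intros)
    show "\<exists>C. \<forall>n s. norm s \<le> R \<longrightarrow> Re s > 1 \<longrightarrow>
        norm (of_nat (Suc n) powr (- s) :: complex) \<le> C * real (Suc n) powr (1 - 1 - Re s)" for R
      by (intro exI[of _ 1] allI impI, subst norm_powr_real_powr) (auto simp del: of_nat_Suc)
  qed
  then have "(\<lambda>s. (s - 1) * (\<Sum>n. of_nat (Suc n) powr (- s))) holomorphic_on {s. Re s > 1 - real 0}"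
    by (intro holomorphic_intros) simp
  then show ?case by blast
next
  case (Suc m)
  then obtain F where hol: "F holomorphic_on {s. Re s > 1 - real m}"
    and eq: "\<And>s. Re s > 1 \<Longrightarrow> F s = (s - 1) * (\<Sum>n. of_nat (Suc n) powr (- s))"
    by blast
  \<comment> \<open>The right side of the recurrence with \<open>binom(1-s, k+1) Z(s+k)\<close>
    rewritten as \<open>- binom(1-s, k) / (k+1) * F(s+k)\<close>. Shifts by \<open>k \<ge> 1\<close>
    land where \<open>F\<close> is already holomorphic, and the remainder series with
    \<open>K = m\<close> converges for \<open>Re s > - m\<close>, one unit further left.\<close>
  define G where "G = (\<lambda>s. 1 - (\<Sum>k=1..m. ((1 - s) gchoose k) / of_nat (Suc k) * F (s + of_nat k))
      + (\<Sum>n. zeta_taylor_rem m n s))"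
  have shift: "(\<lambda>s. F (s + of_nat k)) holomorphic_on {s. Re s > 1 - real (Suc m)}" if "k \<in> {1..m}" for k
    using that by (intro holomorphic_on_compose_gen[OF _ hol, unfolded o_def] holomorphic_intros) auto
  have rem: "(\<lambda>s. \<Sum>n. zeta_taylor_rem m n s) holomorphic_on {s. Re s > 1 - real (Suc m)}"
    using half_plane_series_holomorphic[OF zeta_taylor_rem_holomorphic zeta_taylor_rem_bound, of m]
    by simp
  have "G holomorphic_on {s. Re s > 1 - real (Suc m)}"
    unfolding G_def gbinomial_prod_rev
    by (intro holomorphic_intros shift rem) auto
  moreover have "G s = (s - 1) * (\<Sum>n. of_nat (Suc n) powr (- s))" if s: "Re s > 1" for s
  proof -
    have "((1 - s) gchoose k) / of_nat (Suc k) * F (s + of_nat k) =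
        - (((1 - s) gchoose Suc k) * (\<Sum>n. of_nat (Suc n) powr (- (s + of_nat k))))" for k
    proof -
      have g: "((1 - s) gchoose Suc k) = ((1 - s) gchoose k) * (1 - s - of_nat k) / of_nat (Suc k)"
        by (simp add: gbinomial_prod_rev)
      have F: "F (s + of_nat k) = (s + of_nat k - 1) * (\<Sum>n. of_nat (Suc n) powr (- (s + of_nat k)))"
        using eq[of "s + of_nat k"] s by simp
      show ?thesis unfolding g F by (simp add: field_simps del: of_nat_Suc)
    qed
    then show ?thesis
      unfolding zeta_shift_recurrence[OF s, of m] G_def by (simp add: sum_negf)
  qed
  ultimately show ?case by blast
qed

text \<open>The functions on the half planes all agree on \<open>Re s > 1\<close>, so by the
  identity theorem they agree wherever two of them are defined. Gluing them gives an entire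
  function, and division by \<open>s - 1\<close> leaves a singularity only at 1.\<close>

lemma zeta_continuation_exists: "\<exists>f. zeta_continuation f"
proof -
  obtain F where hol: "\<And>m. F m holomorphic_on {s. Re s > 1 - real m}"
    and eq: "\<And>m s. Re s > 1 \<Longrightarrow> F m s = (s - 1) * (\<Sum>n. of_nat (Suc n) powr (- s))"
    using zeta_continuation_half_plane by metis
  have F_eq: "F l s = F m s" if lm: "l \<le> m" and s: "Re s > 1 - real l" for l m s
  proof (rule analytic_continuation_open[of "{s. Re s > 1}" "{s. Re s > 1 - real l}" "F l" "F m" s])
    have "2 \<in> {s :: complex. Re s > 1}" by simp
    then show "{s :: complex. Re s > 1} \<noteq> {}" by blast
    show "F m holomorphic_on {s. Re s > 1 - real l}"
      using lm by (intro holomorphic_on_subset[OF hol[of m]]) auto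
  qed (use s hol eq in \<open>auto simp: open_halfspace_Re_gt convex_halfspace_Re_gt convex_connected\<close>)
  \<comment> \<open>Index of some half plane containing \<open>s\<close>.\<close>
  define m where "m = (\<lambda>s. Suc (nat \<lceil>1 - Re s\<rceil>))"
  have m: "Re s > 1 - real (m s)" for s unfolding m_def by linarith
  define f where "f = (\<lambda>s. F (m s) s / (s - 1))"
  have f_eq: "f s = F l s / (s - 1)" if "Re s > 1 - real l" for l s
    using F_eq[of l "m s" s] F_eq[of "m s" l s] that m[of s] unfolding f_def by (metis nle_le)
  have "f holomorphic_on (\<Union>l. {s. Re s > 1 - real l} - {1})"
  proof (rule holomorphic_on_UN_open)
    show "open ({s. Re s > 1 - real l} - {1})" for l
      by (intro open_Diff open_halfspace_Re_gt) auto
    have "(\<lambda>s. F l s / (s - 1)) holomorphic_on {s. Re s > 1 - real l} - {1}" for l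
      by (intro holomorphic_intros holomorphic_on_subset[OF hol[of l]]) auto
    then show "f holomorphic_on {s. Re s > 1 - real l} - {1}" for l
      by (rule holomorphic_transform) (use f_eq in auto)
  qed
  also have "(\<Union>l. {s. Re s > 1 - real l} - {1}) = - {1}"
    using m by auto
  finally have "f holomorphic_on - {1}" .
  moreover have "(\<lambda>n. 1 / of_nat (Suc n) powr s) sums f s" if s: "Re s > 1" for s
  proof -
    have "f s = (\<Sum>n. of_nat (Suc n) powr (- s))"
      using f_eq[of 0 s] eq[of s 0] s by auto
    then show ?thesis
      using summable_sums[OF summable_zeta_complex[OF s]] by (simp add: powr_minus_divide)
  qed
  ultimately show ?thesis by (auto simp: zeta_continuation_def)
qed

lemma zeta_continuation_riemann_zeta: "zeta_continuation riemann_zeta"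
  unfolding riemann_zeta_def using zeta_continuation_exists by (rule someI_ex)

section \<open>Partial sums of the zeta series\<close>

text \<open>\<open>1 - s\<close> times the trapezoidal error for \<open>\<integral> x\<^sup>-\<^sup>s dx\<close> on \<open>[n + 1, n + 2]\<close>; the factor keeps it
  entire in \<open>s\<close>.\<close>

definition zeta_trapezoid_term :: "nat \<Rightarrow> complex \<Rightarrow> complex" where
  "zeta_trapezoid_term n s = (1 - s) * (of_nat (Suc n) powr (- s) + of_nat (n + 2) powr (- s)) / 2
     - (of_nat (n + 2) powr (1 - s) - of_nat (Suc n) powr (1 - s))"

lemma zeta_trapezoid_term_holomorphic: "zeta_trapezoid_term n holomorphic_on A"
  unfolding zeta_trapezoid_term_def[abs_def] by (intro holomorphic_intros) auto

text \<open>As a function of the panel length \<open>u\<close>, the error and its first derivative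
  vanish at 0, so the second derivative controls it. The constant bounds
  \<open>(1 - s) s (s + 1) / 2\<close> on the disc.\<close>

lemma zeta_trapezoid_term_bound:
  "\<exists>C. \<forall>n s. norm s \<le> R \<longrightarrow> Re s > - 1 \<longrightarrow>
     norm (zeta_trapezoid_term n s) \<le> C * real (Suc n) powr (- 1 - 1 - Re s)"
proof (intro exI[of _ "(1 + R) * R * (R + 1) / 2"] allI impI)
  fix n s assume s: "norm (s::complex) \<le> R" "Re s > - 1"
  define N where "N = real (Suc n)"
  have N: "N \<ge> 1" by (simp add: N_def)
  define K where "K = (1 + R) * R * (R + 1) / 2"
  have R: "R \<ge> 0" using s(1) norm_ge_zero[of s] by linarith
  \<comment> \<open>Error on \<open>[N, N + u]\<close>, again multiplied by \<open>1 - s\<close>;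
    \<open>E1\<close> and \<open>E2\<close> are its derivatives. In \<open>E2\<close> the terms of
    order \<open>- s - 1\<close> cancel.\<close>
  define E where "E = (\<lambda>u. (1 - s) / 2 * u * (of_real N powr (- s) + (of_real N + u) powr (- s))
      - ((of_real N + u) powr (1 - s) - of_real N powr (1 - s)))"
  define E1 where "E1 = (\<lambda>u. (1 - s) / 2 * (of_real N powr (- s) - (of_real N + u) powr (- s)
      - s * u * (of_real N + u) powr (- s - 1)))"
  define E2 where "E2 = (\<lambda>u. (1 - s) * s * (s + 1) / 2 * u * (of_real N + u) powr (- s - 2))"
  define f where "f = (\<lambda>i::nat. if i = 0 then E else if i = 1 then E1 else E2)"
  have seg: "\<exists>v. u = of_real v \<and> 0 \<le> v \<and> v \<le> 1" if "u \<in> closed_segment 0 (1::complex)" for u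
    using that by (auto simp: in_segment scaleR_conv_of_real)
  have "norm (f 0 1 - (\<Sum>i\<le>1. f i 0 * (1 - 0) ^ i / fact i))
     \<le> (K * N powr (- 2 - Re s)) * norm (1 - 0 :: complex) ^ Suc 1 / fact 1"
  proof (rule complex_Taylor[of "closed_segment 0 1"])
    fix i :: nat and u :: complex
    assume u: "u \<in> closed_segment 0 1" and i: "i \<le> 1"
    obtain v where v: "u = of_real v" "0 \<le> v" "v \<le> 1" using u seg by blast
    have "of_real N + u = of_real (N + v)" by (simp add: v)
    then have nn: "of_real N + u \<notin> \<real>\<^sub>\<le>\<^sub>0"
      using N v by (auto simp only: complex_nonpos_Reals_iff Re_complex_of_real)
    note D = has_field_derivative_shifted_powr[OF nn]
    define p where "p = (of_real N + u) powr (- s - 2)"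
    have p: "(of_real N + u) powr (- s - 1) = (of_real N + u) * p"
        "(of_real N + u) powr (- s - 1 - 1) = p"
    proof -
      have "- s - 1 = 1 + (- s - 2)" by simp
      then show "(of_real N + u) powr (- s - 1) = (of_real N + u) * p"
        using nn by (auto simp only: powr_add powr_to_1 p_def split: if_splits)
      show "(of_real N + u) powr (- s - 1 - 1) = p"
        unfolding p_def by (rule arg_cong[of _ _ "(powr) (of_real N + u)"]) simp
    qed
    have E: "(E has_field_derivative E1 u) (at u within closed_segment 0 1)"
      unfolding E_def E1_def
      by (rule derivative_eq_intros D refl)+ (simp add: field_simps)
    have E1: "(E1 has_field_derivative E2 u) (at u within closed_segment 0 1)"
      unfolding E1_def E2_def
      by (rule D derivative_eq_intros refl)+ (unfold p p_def[symmetric], simp add: field_simps)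
    show "(f i has_field_derivative f (Suc i) u) (at u within closed_segment 0 1)"
      using i E E1 unfolding f_def by (cases i) auto
  next
    fix u :: complex
    assume "u \<in> closed_segment 0 1"
    then obtain v where v: "u = of_real v" "0 \<le> v" "v \<le> 1" using seg by blast
    have "norm (f (Suc 1) u) = norm (1 - s) * norm s * norm (s + 1) / 2 * v * norm (of_real (N + v) powr (- s - 2))"
      unfolding f_def E2_def v using v by (simp add: norm_mult)
    also have "norm (of_real (N + v) powr (- s - 2)) = (N + v) powr (- 2 - Re s)"
      using N v by (subst norm_powr_real_powr) (auto intro!: arg_cong2[where f = "(powr)"])
    also have "norm (1 - s) * norm s * norm (s + 1) / 2 * v * (N + v) powr (- 2 - Re s)
        \<le> (1 + R) * R * (R + 1) / 2 * 1 * N powr (- 2 - Re s)"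
      using N v s R norm_triangle_ineq4[of 1 s] norm_triangle_ineq[of s 1]
      by (intro mult_mono divide_right_mono powr_mono2' mult_nonneg_nonneg) auto
    finally show "norm (f (Suc 1) u) \<le> K * N powr (- 2 - Re s)" by (simp add: K_def)
  qed auto
  also have "f 0 1 - (\<Sum>i\<le>1. f i 0 * (1 - 0) ^ i / fact i) = zeta_trapezoid_term n s"
    by (simp add: f_def E_def E1_def zeta_trapezoid_term_def N_def add_ac)
  finally show "norm (zeta_trapezoid_term n s) \<le> (1 + R) * R * (R + 1) / 2 * real (Suc n) powr (- 1 - 1 - Re s)"
    by (simp add: N_def K_def)
qed

lemma riemann_zeta_sums:
  assumes "Re s > 1"
  shows "(\<lambda>n. of_nat (Suc n) powr (- s)) sums riemann_zeta s"
  using zeta_continuation_riemann_zeta assms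
  by (auto simp: zeta_continuation_def powr_minus_divide)

text \<open>For \<open>Re s > 1\<close> the series can be summed directly from the zeta series and a
  telescoping sum. Both sides are holomorphic on the punctured half plane \<open>Re s > -1\<close>,
  which is connected, so the identity persists there.\<close>

lemma riemann_zeta_trapezoid:
  assumes "Re s > - 1" "s \<noteq> 1"
  shows "(1 - s) * riemann_zeta s = (\<Sum>n. zeta_trapezoid_term n s) + (1 - s) / 2 - 1"
proof (rule analytic_continuation_open[of "{s. Re s > 1}" "{s. Re s > - 1} - {1}" _ _ s])
  show "open {s. Re s > 1}" by (rule open_halfspace_Re_gt)
  show "open ({s. Re s > - 1} - {1})" by (intro open_Diff open_halfspace_Re_gt) auto
  have "2 \<in> {s :: complex. Re s > 1}" by simp
  then show "{s :: complex. Re s > 1} \<noteq> {}" by blast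
  show "connected ({s. Re s > - 1} - {1 :: complex})"
    by (intro connected_open_delete open_halfspace_Re_gt convex_connected convex_halfspace_Re_gt) auto
  have "riemann_zeta holomorphic_on - {1}"
    using zeta_continuation_riemann_zeta by (simp add: zeta_continuation_def)
  then show "(\<lambda>s. (1 - s) * riemann_zeta s) holomorphic_on {s. Re s > - 1} - {1}"
    by (intro holomorphic_intros) (auto elim: holomorphic_on_subset)
  have "(\<lambda>s. \<Sum>n. zeta_trapezoid_term n s) holomorphic_on {s. Re s > - 1}"
    by (rule half_plane_series_holomorphic[OF zeta_trapezoid_term_holomorphic zeta_trapezoid_term_bound])
  then show "(\<lambda>s. (\<Sum>n. zeta_trapezoid_term n s) + (1 - s) / 2 - 1) holomorphic_on {s. Re s > - 1} - {1}"
    by (intro holomorphic_intros) (auto elim: holomorphic_on_subset)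
  fix s :: complex assume "s \<in> {s. Re s > 1}"
  then have s: "Re s > 1" by simp
  have Z: "(\<lambda>n. of_nat (Suc n) powr (- s)) sums riemann_zeta s"
    by (rule riemann_zeta_sums[OF s])
  have Z': "(\<lambda>n. of_nat (n + 2) powr (- s)) sums (riemann_zeta s - 1)"
    using sums_Suc_iff[of "\<lambda>n. of_nat (Suc n) powr (- s)"] Z by (simp add: add_ac)
  have "(\<lambda>n. of_nat (n + 2) powr (1 - s) - of_nat (Suc n) powr (1 - s)) sums (- 1 :: complex)"
    using telescope_sums[OF powr_nat_tendsto_0[of "1 - s"]] s by simp
  from sums_diff[OF sums_divide[OF sums_mult[OF sums_add[OF Z Z'], of "1 - s"], of 2] this]
  have "(\<lambda>n. zeta_trapezoid_term n s) sums
      ((1 - s) * (riemann_zeta s + (riemann_zeta s - 1)) / 2 - - 1)"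
    by (simp only: zeta_trapezoid_term_def)
  from sums_unique[OF this]
  show "(1 - s) * riemann_zeta s = (\<Sum>n. zeta_trapezoid_term n s) + (1 - s) / 2 - 1"
    by (simp add: field_simps)
qed (use assms in auto)

section \<open>Tail estimates and partial sums at real arguments\<close>

text \<open>By the mean value theorem the difference is \<open>(a - 1) z powr (- a)\<close> with
  \<open>z < x + 1 \<le> 2 x\<close>. Bounding a power by a telescoping difference makes tails
  explicit.\<close>

lemma powr_le_powr_diff:
  fixes a x :: real
  assumes "a > 1" "x \<ge> 1"
  shows "x powr (- a) \<le> 2 powr a / (a - 1) * (x powr (1 - a) - (x + 1) powr (1 - a))"
proof -
  have "\<exists>z>x. z < x + 1 \<and> (x + 1) powr (1 - a) - x powr (1 - a) = (x + 1 - x) * ((1 - a) * z powr (- a))"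
    by (rule MVT2) (use assms in \<open>auto intro!: derivative_eq_intros\<close>)
  then obtain z where z: "x < z" "z < x + 1"
    and eq: "x powr (1 - a) - (x + 1) powr (1 - a) = (a - 1) * z powr (- a)"
    by (auto simp: algebra_simps)
  have "2 powr (- a) * x powr (- a) = (2 * x) powr (- a)"
    using assms by (simp add: powr_mult)
  also have "\<dots> \<le> z powr (- a)"
    using z assms by (intro powr_mono2') auto
  finally have "2 powr a * (2 powr (- a) * x powr (- a)) \<le> 2 powr a * z powr (- a)"
    by (intro mult_left_mono) auto
  then have "x powr (- a) \<le> 2 powr a * z powr (- a)"
    by (simp add: mult.assoc[symmetric] flip: powr_add)
  also have "\<dots> = 2 powr a / (a - 1) * (x powr (1 - a) - (x + 1) powr (1 - a))"
    unfolding eq using assms by simp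
  finally show ?thesis .
qed

lemma norm_suminf_tail_le:
  fixes f :: "nat \<Rightarrow> 'a :: banach"
  assumes a: "a > 1" and f: "\<And>n. norm (f n) \<le> C * real (Suc n) powr (- a)"
  shows "\<exists>K. \<forall>N. norm (\<Sum>n. f (n + N)) \<le> K * real (Suc N) powr (1 - a)"
proof (intro exI allI)
  fix N
  define c where "c = \<bar>C\<bar> * (2 powr a / (a - 1))"
  define g where "g = (\<lambda>n. real (Suc (n + N)) powr (1 - a))"
  have "g \<longlonglongrightarrow> 0"
    unfolding g_def using a
    by (intro LIMSEQ_ignore_initial_segment[of "\<lambda>n. real (Suc n) powr (1 - a)", simplified add_Suc_right]
        LIMSEQ_Suc tendsto_neg_powr filterlim_real_sequentially) auto
  from telescope_sums'[OF this]
  have sums: "(\<lambda>n. c * (g n - g (Suc n))) sums (c * g 0)"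
    by (intro sums_mult) simp
  have le: "norm (f (n + N)) \<le> c * (g n - g (Suc n))" for n
  proof -
    have "norm (f (n + N)) \<le> \<bar>C\<bar> * real (Suc (n + N)) powr (- a)"
      using f[of "n + N"] by (rule order_trans) (intro mult_right_mono, auto)
    also have "\<dots> \<le> \<bar>C\<bar> * (2 powr a / (a - 1) * (g n - g (Suc n)))"
      using powr_le_powr_diff[OF a, of "real (Suc (n + N))"] unfolding g_def
      by (intro mult_left_mono) (auto simp: add_ac)
    finally show ?thesis by (simp add: c_def)
  qed
  have "summable (\<lambda>n. norm (f (n + N)))"
    by (rule summable_comparison_test'[OF sums_summable[OF sums], of 0]) (use le in auto)
  then have "norm (\<Sum>n. f (n + N)) \<le> (\<Sum>n. norm (f (n + N)))"
    by (rule summable_norm)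
  also have "\<dots> \<le> (\<Sum>n. c * (g n - g (Suc n)))"
    by (intro suminf_le le \<open>summable _\<close> sums_summable[OF sums])
  also have "\<dots> = c * real (Suc N) powr (1 - a)"
    using sums_unique[OF sums] by (simp add: g_def)
  finally show "norm (\<Sum>n. f (n + N)) \<le> \<bar>C\<bar> * (2 powr a / (a - 1)) * real (Suc N) powr (1 - a)"
    by (simp add: c_def)
qed

text \<open>Inner nodes get half their weight from each adjacent panel. The sum counts the first
  node in full, so half of it is taken off again, and the integrals telescope.\<close>

lemma sum_zeta_trapezoid_term:
  "(\<Sum>n<M. zeta_trapezoid_term n s) =
     (1 - s) * ((\<Sum>k=1..<Suc M. of_nat k powr (- s)) + (of_nat (Suc M) powr (- s) - 1) / 2)
     - of_nat (Suc M) powr (1 - s) + 1"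
proof (induction M)
  case (Suc M)
  have "(\<Sum>k=1..<Suc (Suc M). of_nat k powr (- s)) =
      (\<Sum>k=1..<Suc M. of_nat k powr (- s)) + of_nat (Suc M) powr (- s)"
    by (subst sum.op_ivl_Suc) simp
  then show ?case
    unfolding sum.lessThan_Suc Suc.IH unfolding zeta_trapezoid_term_def
    by (simp add: field_simps del: sum.op_ivl_Suc of_nat_Suc)
qed simp

text \<open>Splitting the series in \<open>riemann_zeta_trapezoid\<close> after \<open>N - 1\<close>
  terms, the initial segment yields the partial sum with its integral and endpoint corrections. What
  remains is the tail of terms of order \<open>n powr (- s - 2)\<close>, divided by
  \<open>1 - s\<close>.\<close>

lemma zeta_real_partial_sum_bound:
  assumes s: "s > - 1" "s \<noteq> 1"
  shows "\<exists>C. \<forall>N\<ge>1. \<bar>(\<Sum>k=1..<N. real k powr (- s)) - zeta_real s - real N powr (1 - s) / (1 - s)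
            + real N powr (- s) / 2\<bar> \<le> C * real N powr (- s - 1)"
proof -
  define T where "T = (\<lambda>n. zeta_trapezoid_term n (of_real s))"
  obtain C where C': "\<And>n z. norm z \<le> \<bar>s\<bar> \<Longrightarrow> Re z > - 1 \<Longrightarrow>
      norm (zeta_trapezoid_term n z) \<le> C * real (Suc n) powr (- 1 - 1 - Re z)"
    using zeta_trapezoid_term_bound by meson
  have C: "norm (T n) \<le> C * real (Suc n) powr (- (2 + s))" for n
    using C'[of "of_real s" n] s(1) by (simp add: T_def)
  have "1 - (2 + s) = - s - 1" by simp
  with norm_suminf_tail_le[OF _ C] s(1)
  obtain K where K: "\<And>N. norm (\<Sum>n. T (n + N)) \<le> K * real (Suc N) powr (- s - 1)"
    by auto
  have summ: "summable T"
    unfolding T_def using s(1)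
    by (intro half_plane_series_summable[OF zeta_trapezoid_term_holomorphic zeta_trapezoid_term_bound]) auto
  show ?thesis
  proof (intro exI[of _ "K / \<bar>1 - s\<bar>"] allI impI)
    fix N :: nat assume "N \<ge> 1"
    then obtain M where M: "N = Suc M" by (cases N) auto
    define e where "e = (\<Sum>k=1..<N. real k powr (- s)) - zeta_real s - real N powr (1 - s) / (1 - s)
            + real N powr (- s) / 2"
    \<comment> \<open>Everything except the tail is real, so taking real parts turns the complex
      identity into one for \<open>zeta_real\<close>.\<close>
    have pr: "of_nat k powr (of_real r :: complex) = of_real (real k powr r)" for k r
      using powr_of_real[of "real k" r] by simp
    have "(1 - of_real s) * riemann_zeta (of_real s) =
        (\<Sum>n. T (n + M)) + (\<Sum>n<M. T n) + (1 - of_real s) / 2 - 1"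
      using riemann_zeta_trapezoid[of "of_real s"] s suminf_split_initial_segment[OF summ, of M]
      by (simp add: T_def)
    also have "(\<Sum>n<M. T n) = of_real ((1 - s) * ((\<Sum>k=1..<N. real k powr (- s)) + (real N powr (- s) - 1) / 2)
     - real N powr (1 - s) + 1)"
      unfolding T_def sum_zeta_trapezoid_term M
      by (simp add: pr[symmetric] del: of_nat_Suc sum.op_ivl_Suc)
    finally have "Re ((1 - of_real s) * riemann_zeta (of_real s)) =
      Re ((\<Sum>n. T (n + M)) + of_real ((1 - s) * ((\<Sum>k=1..<N. real k powr (- s)) + (real N powr (- s) - 1) / 2)
     - real N powr (1 - s) + 1) + (1 - of_real s) / 2 - 1)"
      by (rule arg_cong)
    then have "(1 - s) * zeta_real s = Re (\<Sum>n. T (n + M)) + 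
       (1 - s) * ((\<Sum>k=1..<N. real k powr (- s)) + (real N powr (- s) - 1) / 2)
     - real N powr (1 - s) + (1 - s) / 2"
      by (simp add: zeta_real_def)
    moreover define Q where "Q = real N powr (1 - s) / (1 - s)"
    then have "real N powr (1 - s) = (1 - s) * Q" using s(2) by simp
    ultimately have "(1 - s) * e = - Re (\<Sum>n. T (n + M))"
      unfolding e_def Q_def[symmetric] by (simp add: field_simps)
    then have "\<bar>1 - s\<bar> * \<bar>e\<bar> \<le> norm (\<Sum>n. T (n + M))"
      using abs_Re_le_cmod[of "\<Sum>n. T (n + M)"] by (simp add: abs_mult[symmetric])
    also have "\<dots> \<le> K * real N powr (- s - 1)"
      using K[of M] by (simp add: M)
    finally show "\<bar>e\<bar> \<le> K / \<bar>1 - s\<bar> * real N powr (- s - 1)"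
      using s(2) by (simp add: field_simps)
  qed
qed

section \<open>The trapezoidal rule\<close>

text \<open>Scaled by \<open>n\<close>, that is, divided by the mesh width, so that it compares
  directly with the unweighted sums over \<open>k\<close>.\<close>

definition trapezoid_error :: "(real \<Rightarrow> real) \<Rightarrow> nat \<Rightarrow> real" where
  "trapezoid_error g n =
     (\<Sum>k=1..<n. g (real k / real n)) + (g 0 + g 1) / 2 - real n * integral {0..1} g"

lemma trapezoid_error_add:
  assumes "continuous_on {0..1} f" "continuous_on {0..1} g"
  shows "trapezoid_error (\<lambda>x. f x + g x) n = trapezoid_error f n + trapezoid_error g n"
  using assms by (simp add: trapezoid_error_def sum.distrib integral_add integrable_continuous_real
      field_simps)

lemma trapezoid_error_diff:
  assumes "continuous_on {0..1} f" "continuous_on {0..1} g"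
  shows "trapezoid_error (\<lambda>x. f x - g x) n = trapezoid_error f n - trapezoid_error g n"
  using assms by (simp add: trapezoid_error_def sum_subtractf integral_diff integrable_continuous_real
      field_simps)

lemma trapezoid_error_mult: "trapezoid_error (\<lambda>x. c * f x) n = c * trapezoid_error f n"
  by (simp add: trapezoid_error_def sum_distrib_left[symmetric] algebra_simps)

section \<open>Convexity and the sign of the trapezoidal error\<close>

text \<open>Compare mean slopes to the left and right of \<open>x\<close>. Derivatives are required
  only in the interior because the comparison functions have unbounded derivatives at the
  endpoints.\<close>

lemma DERIV2_nonneg_imp_le_chord:
  fixes f f' f'' :: "real \<Rightarrow> real"
  assumes ab: "a < b" and cont: "continuous_on {a..b} f"
    and f': "\<And>x. a < x \<Longrightarrow> x < b \<Longrightarrow> (f has_real_derivative f' x) (at x)"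
    and f'': "\<And>x. a < x \<Longrightarrow> x < b \<Longrightarrow> (f' has_real_derivative f'' x) (at x)"
    and nonneg: "\<And>x. a < x \<Longrightarrow> x < b \<Longrightarrow> f'' x \<ge> 0"
    and x: "x \<in> {a..b}"
  shows "f x \<le> f a + (x - a) * ((f b - f a) / (b - a))"
proof (cases "x = a \<or> x = b")
  case True
  then show ?thesis using ab by auto
next
  case False
  then have x: "a < x" "x < b" using x by auto
  have conts: "continuous_on {a..x} f" "continuous_on {x..b} f"
    using x by (auto intro: continuous_on_subset[OF cont])
  have der: "(f has_derivative (*) (f' z)) (at z)" if "a < z" "z < b" for z
    using f'[OF that] by (simp add: has_field_derivative_def)
  obtain u where u: "a < u" "u < x" "f x - f a = f' u * (x - a)"
    by (rule mvt[of a x f "\<lambda>z. (*) (f' z)"]) (use x conts der in auto)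
  obtain v where v: "x < v" "v < b" "f b - f x = f' v * (b - x)"
    by (rule mvt[of x b f "\<lambda>z. (*) (f' z)"]) (use x conts der in auto)
  have "f' u \<le> f' v"
  proof (rule DERIV_nonneg_imp_nondecreasing[of u v f'])
    show "\<exists>y. (f' has_real_derivative y) (at z) \<and> y \<ge> 0" if "u \<le> z" "z \<le> v" for z
      using f''[of z] nonneg[of z] that u v x by (intro exI[of _ "f'' z"]) auto
  qed (use u v in auto)
  then have "(f x - f a) * (b - x) \<le> (f b - f x) * (x - a)"
    unfolding u(3) v(3) using x mult_right_mono[of "f' u" "f' v" "(x - a) * (b - x)"]
    by (simp add: mult_ac)
  then have "(f x - f a) * (b - a) \<le> (x - a) * (f b - f a)"
    by (simp add: algebra_simps)
  then show ?thesis using ab by (simp add: field_simps)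
qed

lemma DERIV2_nonneg_imp_integral_le:
  fixes f f' f'' :: "real \<Rightarrow> real"
  assumes ab: "a < b" and cont: "continuous_on {a..b} f"
    and f': "\<And>x. a < x \<Longrightarrow> x < b \<Longrightarrow> (f has_real_derivative f' x) (at x)"
    and f'': "\<And>x. a < x \<Longrightarrow> x < b \<Longrightarrow> (f' has_real_derivative f'' x) (at x)"
    and nonneg: "\<And>x. a < x \<Longrightarrow> x < b \<Longrightarrow> f'' x \<ge> 0"
  shows "integral {a..b} f \<le> (b - a) * ((f a + f b) / 2)"
proof -
  define m where "m = (f b - f a) / (b - a)"
  have "((\<lambda>x. f a + (x - a) * m) has_integral
      (f a * b + (b - a)\<^sup>2 / 2 * m - (f a * a + (a - a)\<^sup>2 / 2 * m))) {a..b}"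
    using ab by (intro fundamental_theorem_of_calculus)
      (auto intro!: derivative_eq_intros simp: field_simps
        simp flip: has_real_derivative_iff_has_vector_derivative)
  moreover have "(f has_integral integral {a..b} f) {a..b}"
    by (intro integrable_integral integrable_continuous_real cont)
  moreover have "f x \<le> f a + (x - a) * m" if "x \<in> {a..b}" for x
    using DERIV2_nonneg_imp_le_chord[OF assms that] by (simp add: m_def)
  ultimately have "integral {a..b} f \<le> f a * b + (b - a)\<^sup>2 / 2 * m - (f a * a + (a - a)\<^sup>2 / 2 * m)"
    using has_integral_le by blast
  also have "\<dots> = f a * (b - a) + (b - a) * ((b - a) * m) / 2"
    by (simp add: power2_eq_square algebra_simps)
  also have "(b - a) * m = f b - f a" using ab by (simp add: m_def)
  also have "f a * (b - a) + (b - a) * (f b - f a) / 2 = (b - a) * ((f a + f b) / 2)"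
    by (simp add: field_simps)
  finally show ?thesis .
qed

lemma sum_trapezoid:
  fixes g :: "nat \<Rightarrow> real"
  shows "(\<Sum>k<Suc m. (g k + g (Suc k)) / 2) = (\<Sum>k=1..<Suc m. g k) + (g 0 + g (Suc m)) / 2"
proof (induction m)
  case (Suc m)
  have "(\<Sum>k=1..<Suc (Suc m). g k) = (\<Sum>k=1..<Suc m. g k) + g (Suc m)"
    by (subst sum.op_ivl_Suc) simp
  then show ?case
    unfolding sum.lessThan_Suc[of _ "Suc m"] Suc.IH by (simp add: field_simps del: sum.op_ivl_Suc)
qed simp

lemma trapezoid_error_nonneg:
  fixes f f' f'' :: "real \<Rightarrow> real"
  assumes cont: "continuous_on {0..1} f"
    and f': "\<And>x. 0 < x \<Longrightarrow> x < 1 \<Longrightarrow> (f has_real_derivative f' x) (at x)"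
    and f'': "\<And>x. 0 < x \<Longrightarrow> x < 1 \<Longrightarrow> (f' has_real_derivative f'' x) (at x)"
    and nonneg: "\<And>x. 0 < x \<Longrightarrow> x < 1 \<Longrightarrow> f'' x \<ge> 0"
    and n: "n \<ge> 1"
  shows "trapezoid_error f n \<ge> 0"
proof -
  \<comment> \<open>Panel by panel: up to each node \<open>m / n\<close>, the convex function lies
    below its chords.\<close>
  have le: "real n * integral {0..real m / real n} f
      \<le> (\<Sum>k<m. (f (real k / real n) + f (real (Suc k) / real n)) / 2)" if "m \<le> n" for m
    using that
  proof (induction m)
    case (Suc m)
    let ?a = "real m / real n" and ?b = "real (Suc m) / real n"
    have ab: "0 \<le> ?a" "?a < ?b" "?b \<le> 1"
      using Suc.prems n by (auto simp: divide_strict_right_mono)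
    have pos: "0 < x" if "?a < x" for x using ab(1) that by linarith
    have "integral {?a..?b} f \<le> (?b - ?a) * ((f ?a + f ?b) / 2)"
      using ab by (intro DERIV2_nonneg_imp_integral_le[of _ _ f f' f''] f' f'' nonneg
          continuous_on_subset[OF cont]) (auto intro: pos)
    then have "real n * integral {?a..?b} f \<le> (real n * (?b - ?a)) * ((f ?a + f ?b) / 2)"
      using n unfolding mult.assoc by (intro mult_left_mono) auto
    also have "real n * (?b - ?a) = 1" using n by (simp add: field_simps)
    finally have "real n * integral {?a..?b} f \<le> (f ?a + f ?b) / 2" by simp
    moreover have "integral {0..?a} f + integral {?a..?b} f = integral {0..?b} f"
      using ab by (intro Henstock_Kurzweil_Integration.integral_combine integrable_continuous_real continuous_on_subset[OF cont]) auto
    then have "real n * integral {0..?b} f = real n * integral {0..?a} f + real n * integral {?a..?b} f"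
      by (metis distrib_left)
    ultimately show ?case
      unfolding sum.lessThan_Suc using Suc.IH[OF Suc_leD[OF Suc.prems]] by linarith
  qed simp
  obtain m where m: "n = Suc m" using n by (cases n) auto
  show ?thesis
    using le[of n] n sum_trapezoid[of "\<lambda>k. f (real k / real n)" m]
    by (simp add: trapezoid_error_def m del: of_nat_Suc sum.op_ivl_Suc sum.lessThan_Suc)
qed

lemma continuous_on_powr_unit:
  fixes a :: real
  assumes "a > 0"
  shows "continuous_on {0..1} (\<lambda>x. x powr a)"
    and "continuous_on {0..1} (\<lambda>x. (1 - x) powr a)"
  by (intro continuous_on_powr'[OF _ continuous_on_const] continuous_intros; use assms in simp)+

text \<open>For \<open>a < 0\<close> the integrand is unbounded, but the antiderivative is
  continuous up to the endpoints, so the interior form of the fundamental theorem applies.\<close>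

lemma has_integral_powr_unit:
  fixes a :: real
  assumes "a > - 1"
  shows "((\<lambda>x. x powr a) has_integral 1 / (1 + a)) {0..1}"
    and "((\<lambda>x. (1 - x) powr a) has_integral 1 / (1 + a)) {0..1}"
proof -
  have "((\<lambda>x. x powr a) has_integral (1 powr (1 + a) / (1 + a) - 0 powr (1 + a) / (1 + a))) {0..1}"
    using assms by (intro fundamental_theorem_of_calculus_interior continuous_on_divide
        continuous_on_minus continuous_on_powr_unit)
      (auto intro!: derivative_eq_intros
        simp flip: has_real_derivative_iff_has_vector_derivative)
  then show "((\<lambda>x. x powr a) has_integral 1 / (1 + a)) {0..1}" by simp
  have "((\<lambda>x. (1 - x) powr a) has_integral (- ((1 - 1) powr (1 + a)) / (1 + a) - - ((1 - 0) powr (1 + a)) / (1 + a))) {0..1}"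
    using assms by (intro fundamental_theorem_of_calculus_interior continuous_on_divide
        continuous_on_minus continuous_on_powr_unit)
      (auto intro!: derivative_eq_intros
        simp flip: has_real_derivative_iff_has_vector_derivative)
  then show "((\<lambda>x. (1 - x) powr a) has_integral 1 / (1 + a)) {0..1}" by simp
qed

text \<open>Homogeneity pulls out \<open>n powr (- a)\<close>; the endpoints contribute
  \<open>(0 + 1) / 2\<close>. The second claim is the reflection
  \<open>k \<mapsto> n - k\<close>.\<close>

lemma trapezoid_error_powr:
  fixes a :: real
  assumes a: "a > 0" and n: "n \<ge> 1"
  shows "trapezoid_error (\<lambda>x. x powr a) n = real n powr (- a) *
           ((\<Sum>k=1..<n. real k powr a) - real n powr (1 + a) / (1 + a) + real n powr a / 2)"
    and "trapezoid_error (\<lambda>x. (1 - x) powr a) n = trapezoid_error (\<lambda>x. x powr a) n"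
proof -
  have "(real k / real n) powr a = real n powr (- a) * real k powr a" for k
    by (simp add: powr_divide powr_minus field_simps)
  then have "(\<Sum>k=1..<n. (real k / real n) powr a) = real n powr (- a) * (\<Sum>k=1..<n. real k powr a)"
    by (simp add: sum_distrib_left)
  moreover have "real n powr (- a) * real n powr (1 + a) = real n"
    using n by (simp flip: powr_add)
  moreover have "real n powr (- a) * real n powr a = 1"
    using n by (simp flip: powr_add)
  ultimately show "trapezoid_error (\<lambda>x. x powr a) n = real n powr (- a) *
           ((\<Sum>k=1..<n. real k powr a) - real n powr (1 + a) / (1 + a) + real n powr a / 2)"
    using integral_unique[OF has_integral_powr_unit(1), of a] a
    by (simp add: trapezoid_error_def right_diff_distrib distrib_left)
  have "(\<Sum>k=1..<n. (1 - real k / real n) powr a) = (\<Sum>k=1..<n. (real k / real n) powr a)"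
    using n by (intro sum.reindex_bij_witness[of _ "\<lambda>k. n - k" "\<lambda>k. n - k"])
      (auto simp: of_nat_diff diff_divide_distrib)
  then show "trapezoid_error (\<lambda>x. (1 - x) powr a) n = trapezoid_error (\<lambda>x. x powr a) n"
    using integral_unique[OF has_integral_powr_unit(1), of a]
      integral_unique[OF has_integral_powr_unit(2), of a] a
    by (simp add: trapezoid_error_def)
qed

text \<open>The bracket in \<open>trapezoid_error_powr\<close> is the partial-sum expansion at
  \<open>s = - a\<close>, where \<open>a < 1\<close> ensures \<open>s > -1\<close>.\<close>

lemma trapezoid_error_powr_asymp:
  fixes a :: real
  assumes a: "0 < a" "a < 1"
  shows "\<exists>C. \<forall>n\<ge>1. \<bar>trapezoid_error (\<lambda>x. x powr a) n - zeta_real (- a) * real n powr (- a)\<bar> \<le> C / real n"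
proof -
  obtain C where C: "\<And>n. n \<ge> 1 \<Longrightarrow> \<bar>(\<Sum>k=1..<n. real k powr a) - zeta_real (- a) - real n powr (1 + a) / (1 + a)
            + real n powr a / 2\<bar> \<le> C * real n powr (a - 1)"
    using zeta_real_partial_sum_bound[of "- a"] a by auto
  show ?thesis
  proof (intro exI[of _ C] allI impI)
    fix n :: nat assume n: "n \<ge> 1"
    have "\<bar>trapezoid_error (\<lambda>x. x powr a) n - zeta_real (- a) * real n powr (- a)\<bar>
       = \<bar>real n powr (- a) * ((\<Sum>k=1..<n. real k powr a) - zeta_real (- a) - real n powr (1 + a) / (1 + a)
            + real n powr a / 2)\<bar>"
      unfolding trapezoid_error_powr(1)[OF a(1) n] by (simp add: algebra_simps)
    also have "\<dots> \<le> real n powr (- a) * (C * real n powr (a - 1))"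
      unfolding abs_mult using C[OF n] by (intro mult_mono) auto
    also have "\<dots> = C * (real n powr (- a) * real n powr (a - 1))"
      by (rule mult.left_commute)
    also have "real n powr (- a) * real n powr (a - 1) = 1 / real n"
      using n powr_add[of "real n" "- a" "a - 1"] by (simp add: powr_minus_divide)
    also have "C * (1 / real n) = C / real n" by simp
    finally show "\<bar>trapezoid_error (\<lambda>x. x powr a) n - zeta_real (- a) * real n powr (- a)\<bar> \<le> C / real n" .
  qed
qed

text \<open>For \<open>B\<close> with second derivative equal to the assumed bound, both \<open>B + g\<close> and \<open>B - g\<close> are convex,
  hence \<open>\<bar>trapezoid_error g n\<bar> \<le> trapezoid_error B n\<close>; the latter is a sum of powers.\<close>

lemma trapezoid_error_bound:
  fixes g g' g'' :: "real \<Rightarrow> real"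
  assumes \<alpha>: "0 < \<alpha>" "\<alpha> < 1"
    and cont: "continuous_on {0..1} g"
    and g': "\<And>x. 0 < x \<Longrightarrow> x < 1 \<Longrightarrow> (g has_real_derivative g' x) (at x)"
    and g'': "\<And>x. 0 < x \<Longrightarrow> x < 1 \<Longrightarrow> (g' has_real_derivative g'' x) (at x)"
    and bound: "\<And>x. 0 < x \<Longrightarrow> x < 1 \<Longrightarrow>
        \<bar>g'' x\<bar> \<le> M * (x powr (- \<alpha> - 1) + (1 - x) powr (- \<alpha> - 1))"
  shows "\<exists>C. \<forall>n\<ge>1. \<bar>trapezoid_error g n\<bar> \<le> C * real n powr (\<alpha> - 1)"
proof -
  \<comment> \<open>Differentiating \<open>- c * x powr (1 - \<alpha>)\<close> twice gives
    \<open>c * \<alpha> * (1 - \<alpha>) * x powr (- \<alpha> - 1)\<close>, and this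
    \<open>c\<close> makes the coefficient \<open>M\<close>.\<close>
  define c where "c = M / (\<alpha> * (1 - \<alpha>))"
  define P where "P = (\<lambda>x::real. x powr (1 - \<alpha>))"
  define B where "B = (\<lambda>x. - c * (P x + P (1 - x)))"
  define B' where "B' = (\<lambda>x. - c * (1 - \<alpha>) * (x powr (- \<alpha>) - (1 - x) powr (- \<alpha>)))"
  define B'' where "B'' = (\<lambda>x. M * (x powr (- \<alpha> - 1) + (1 - x) powr (- \<alpha> - 1)))"
  have contP: "continuous_on {0..1} P" "continuous_on {0..1} (\<lambda>x. P (1 - x))"
    unfolding P_def using \<alpha> by (auto intro!: continuous_on_powr_unit)
  have contB: "continuous_on {0..1} B"
    unfolding B_def by (intro continuous_intros contP)
  have B': "(B has_real_derivative B' x) (at x)" if "0 < x" "x < 1" for x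
    unfolding B_def B'_def P_def using that
    by (auto intro!: derivative_eq_intros simp: algebra_simps)
  have cM: "c * (1 - \<alpha>) * \<alpha> = M" using \<alpha> by (simp add: c_def)
  have B'': "(B' has_real_derivative B'' x) (at x)" if "0 < x" "x < 1" for x
    unfolding B'_def B''_def cM[symmetric] using that
    by (auto intro!: derivative_eq_intros simp: algebra_simps)
  have nonneg1: "trapezoid_error (\<lambda>x. B x + g x) n \<ge> 0" if n: "n \<ge> 1" for n
  proof (rule trapezoid_error_nonneg[of _ "\<lambda>x. B' x + g' x" "\<lambda>x. B'' x + g'' x"])
    show "B'' x + g'' x \<ge> 0" if "0 < x" "x < 1" for x
      using bound[OF that] unfolding B''_def by linarith
    show "continuous_on {0..1} (\<lambda>x. B x + g x)" by (intro continuous_intros contB cont)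
  qed (use n in \<open>auto intro!: DERIV_add B' B'' g' g''\<close>)
  have nonneg2: "trapezoid_error (\<lambda>x. B x - g x) n \<ge> 0" if n: "n \<ge> 1" for n
  proof (rule trapezoid_error_nonneg[of _ "\<lambda>x. B' x - g' x" "\<lambda>x. B'' x - g'' x"])
    show "B'' x - g'' x \<ge> 0" if "0 < x" "x < 1" for x
      using bound[OF that] unfolding B''_def by linarith
    show "continuous_on {0..1} (\<lambda>x. B x - g x)" by (intro continuous_intros contB cont)
  qed (use n in \<open>auto intro!: DERIV_diff B' B'' g' g''\<close>)
  have le: "\<bar>trapezoid_error g n\<bar> \<le> 2 * \<bar>c\<bar> * \<bar>trapezoid_error P n\<bar>" if n: "n \<ge> 1" for n
  proof -
    have "\<bar>trapezoid_error g n\<bar> \<le> trapezoid_error B n"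
      using nonneg1[OF n] nonneg2[OF n] unfolding trapezoid_error_add[OF contB cont] trapezoid_error_diff[OF contB cont]
      by linarith
    also have "trapezoid_error B n = - c * (2 * trapezoid_error P n)"
      using trapezoid_error_powr(2)[of "1 - \<alpha>" n] \<alpha> n
      unfolding B_def trapezoid_error_mult trapezoid_error_add[OF contP] by (simp add: P_def)
    also have "\<dots> \<le> \<bar>- c * (2 * trapezoid_error P n)\<bar>" by (rule abs_ge_self)
    finally show ?thesis by (simp add: abs_mult)
  qed
  obtain C where C: "\<And>n. n \<ge> 1 \<Longrightarrow> \<bar>trapezoid_error P n - zeta_real (\<alpha> - 1) * real n powr (\<alpha> - 1)\<bar> \<le> C / real n"
    using trapezoid_error_powr_asymp[of "1 - \<alpha>"] \<alpha> unfolding P_def by auto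
  show ?thesis
  proof (intro exI[of _ "2 * \<bar>c\<bar> * (\<bar>zeta_real (\<alpha> - 1)\<bar> + \<bar>C\<bar>)"] allI impI)
    fix n :: nat assume n: "n \<ge> 1"
    \<comment> \<open>The correction \<open>C / n\<close> is of lower order because
      \<open>\<alpha> - 1 > -1\<close>.\<close>
    have "C / real n \<le> \<bar>C\<bar> * real n powr (- 1)"
      using n by (simp add: powr_minus_divide divide_right_mono)
    also have "\<dots> \<le> \<bar>C\<bar> * real n powr (\<alpha> - 1)"
      using n \<alpha> by (intro mult_left_mono powr_mono) auto
    finally have "\<bar>trapezoid_error P n\<bar> \<le> \<bar>zeta_real (\<alpha> - 1) * real n powr (\<alpha> - 1)\<bar> + \<bar>C\<bar> * real n powr (\<alpha> - 1)"
      using C[OF n] by linarith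
    also have "\<dots> = (\<bar>zeta_real (\<alpha> - 1)\<bar> + \<bar>C\<bar>) * real n powr (\<alpha> - 1)"
      by (simp add: abs_mult distrib_right)
    finally have "2 * \<bar>c\<bar> * \<bar>trapezoid_error P n\<bar> \<le> 2 * \<bar>c\<bar> * ((\<bar>zeta_real (\<alpha> - 1)\<bar> + \<bar>C\<bar>) * real n powr (\<alpha> - 1))"
      by (intro mult_left_mono) auto
    with le[OF n] show "\<bar>trapezoid_error g n\<bar> \<le> 2 * \<bar>c\<bar> * (\<bar>zeta_real (\<alpha> - 1)\<bar> + \<bar>C\<bar>) * real n powr (\<alpha> - 1)"
      by (simp add: mult.assoc)
  qed
qed

section \<open>The regular part of the kernel\<close>

definition powr_taylor_rem :: "real \<Rightarrow> real \<Rightarrow> real" where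
  "powr_taylor_rem \<beta> x = (1 - x) powr \<beta> - 1 + \<beta> * x"

text \<open>What is left of \<open>(1 - x)\<^sup>\<beta> x\<^sup>-\<^sup>1\<^sup>-\<^sup>\<alpha>\<close> after removing its two most singular terms at \<open>0\<close>. Since
  \<open>0 powr a = 0\<close> in HOL, its value at \<open>0\<close> is the correct limit.\<close>

definition regular_part :: "real \<Rightarrow> real \<Rightarrow> real \<Rightarrow> real" where
  "regular_part \<alpha> \<beta> x = x powr (- \<alpha> - 1) * powr_taylor_rem \<beta> x"

lemma powr_taylor_rem_DERIV:
  assumes "x < 1"
  shows "(powr_taylor_rem \<beta> has_real_derivative \<beta> - \<beta> * (1 - x) powr (\<beta> - 1)) (at x within A)"
    and "((\<lambda>x. \<beta> - \<beta> * (1 - x) powr (\<beta> - 1)) has_real_derivative \<beta> * (\<beta> - 1) * (1 - x) powr (\<beta> - 2)) (at x within A)"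
  unfolding powr_taylor_rem_def[abs_def] using assms
  by (auto intro!: derivative_eq_intros simp: algebra_simps)

lemma powr_minus2_le:
  fixes \<beta> u :: real
  assumes "\<beta> > 0" "1 / 2 \<le> u" "u \<le> 1"
  shows "u powr (\<beta> - 2) \<le> 4"
proof -
  have "u powr (\<beta> - 2) \<le> u powr (- 2)"
    using assms by (intro powr_mono') auto
  also have "\<dots> \<le> (1 / 2) powr (- 2)"
    using assms by (intro powr_mono2') auto
  also have "\<dots> = (4 :: real)" by (simp add: powr_minus powr_divide)
  finally show ?thesis .
qed

text \<open>The mean value inequality is applied downwards from the second derivative; each step
  gains a factor \<open>x\<close> because the remainder and its derivative vanish at 0. Staying in
  \<open>x \<le> 1 / 2\<close> avoids the singularity at 1.\<close>

lemma powr_taylor_rem_bounds: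
  fixes \<beta> x :: real
  assumes \<beta>: "\<beta> > 0" and x: "0 \<le> x" "x \<le> 1 / 2"
  defines "K \<equiv> 4 * \<bar>\<beta> * (\<beta> - 1)\<bar>"
  shows "\<bar>\<beta> * (\<beta> - 1) * (1 - x) powr (\<beta> - 2)\<bar> \<le> K"
    and "\<bar>\<beta> - \<beta> * (1 - x) powr (\<beta> - 1)\<bar> \<le> K * x"
    and "\<bar>powr_taylor_rem \<beta> x\<bar> \<le> K * x\<^sup>2"
proof -
  have 2: "\<bar>\<beta> * (\<beta> - 1) * (1 - x) powr (\<beta> - 2)\<bar> \<le> K" if "0 \<le> x" "x \<le> 1 / 2" for x
  proof -
    have "\<bar>\<beta> * (\<beta> - 1)\<bar> * (1 - x) powr (\<beta> - 2) \<le> \<bar>\<beta> * (\<beta> - 1)\<bar> * 4"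
      using powr_minus2_le[of \<beta> "1 - x"] \<beta> that by (intro mult_left_mono) auto
    then show ?thesis by (simp add: K_def abs_mult)
  qed
  have 1: "\<bar>\<beta> - \<beta> * (1 - x) powr (\<beta> - 1)\<bar> \<le> K * x" if "0 \<le> x" "x \<le> 1 / 2" for x
    using field_differentiable_bound[OF _ powr_taylor_rem_DERIV(2), of "{0..1/2}" \<beta> K 0 x] 2 that
    by (simp add: abs_minus_commute)
  have 0: "\<bar>powr_taylor_rem \<beta> x\<bar> \<le> K * x * x"
  proof -
    have "\<bar>powr_taylor_rem \<beta> 0 - powr_taylor_rem \<beta> x\<bar> \<le> K * x * \<bar>0 - x\<bar>"
      unfolding real_norm_def[symmetric]
    proof (rule field_differentiable_bound[OF _ powr_taylor_rem_DERIV(1), of "{0..x}"])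
      fix z assume "z \<in> {0..x}"
      then have "\<bar>\<beta> - \<beta> * (1 - z) powr (\<beta> - 1)\<bar> \<le> K * z" "K * z \<le> K * x"
        using 1[of z] x by (auto simp: K_def mult_left_mono)
      then show "norm (\<beta> - \<beta> * (1 - z) powr (\<beta> - 1)) \<le> K * x" by simp
    qed (use x in auto)
    then show ?thesis using x by (simp add: powr_taylor_rem_def)
  qed
  show "\<bar>\<beta> * (\<beta> - 1) * (1 - x) powr (\<beta> - 2)\<bar> \<le> K"
    "\<bar>\<beta> - \<beta> * (1 - x) powr (\<beta> - 1)\<bar> \<le> K * x"
    "\<bar>powr_taylor_rem \<beta> x\<bar> \<le> K * x\<^sup>2"
    using 2[OF x] 1[OF x] 0 by (simp_all add: power2_eq_square mult.assoc)
qed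

lemma powr_mult_self:
  fixes x a b :: real
  assumes "x \<ge> 0" "b = a + 1"
  shows "x powr a * x = x powr b"
  using assms by (cases "x = 0") (simp_all add: powr_add)

text \<open>Only 0 is delicate: the quadratic remainder beats \<open>x powr (- \<alpha> - 1)\<close>
  and leaves a multiple of \<open>x powr (1 - \<alpha>)\<close>, which tends to 0.\<close>

lemma continuous_on_regular_part:
  assumes \<alpha>: "0 < \<alpha>" "\<alpha> < 1" and \<beta>: "\<beta> > 0"
  shows "continuous_on {0..1} (regular_part \<alpha> \<beta>)"
  unfolding continuous_on_eq_continuous_within
proof
  fix x :: real assume x: "x \<in> {0..1}"
  show "continuous (at x within {0..1}) (regular_part \<alpha> \<beta>)"
  proof (cases "x = 0")
    case False
    have "continuous_on {0<..1} (regular_part \<alpha> \<beta>)"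
      unfolding regular_part_def[abs_def] powr_taylor_rem_def using \<beta>
      by (intro continuous_intros continuous_on_subset[OF continuous_on_powr_unit(2)[OF \<beta>]]) auto
    then have "continuous (at x within {0<..1}) (regular_part \<alpha> \<beta>)"
      using x False by (auto simp: continuous_on_eq_continuous_within)
    moreover have "at x within {0..1} = at x within {0<..1}"
      by (rule at_within_nhd[of _ "{0<..}"]) (use x False in auto)
    ultimately show ?thesis by simp
  next
    case True
    define K where "K = 4 * \<bar>\<beta> * (\<beta> - 1)\<bar>"
    have "((\<lambda>x. x powr (1 - \<alpha>)) \<longlongrightarrow> 0 powr (1 - \<alpha>)) (at (0::real) within {0..1})"
      by (rule continuous_on_powr_unit(1)[unfolded continuous_on_def, rule_format]) (use \<alpha> in auto)
    from tendsto_mult_left[OF this, of K] have lim: "((\<lambda>x. K * x powr (1 - \<alpha>)) \<longlongrightarrow> 0) (at 0 within {0..1})" by simp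
    have "\<forall>\<^sub>F x in at 0 within {0..1}. norm (regular_part \<alpha> \<beta> x) \<le> K * x powr (1 - \<alpha>)"
      unfolding eventually_at
    proof (intro exI[of _ "1 / 2"] conjI ballI impI)
      fix x :: real assume "x \<in> {0..1}" "x \<noteq> 0 \<and> dist x 0 < 1 / 2"
      then have x: "0 \<le> x" "x \<le> 1 / 2" by auto
      have "norm (regular_part \<alpha> \<beta> x) \<le> x powr (- \<alpha> - 1) * (K * x\<^sup>2)"
        unfolding regular_part_def norm_mult using powr_taylor_rem_bounds(3)[OF \<beta> x]
        by (intro mult_mono) (auto simp: K_def)
      also have "\<dots> = K * (x powr (- \<alpha> - 1) * x * x)"
        by (simp add: power2_eq_square mult_ac)
      also have "x powr (- \<alpha> - 1) * x * x = x powr (1 - \<alpha>)"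
        using x powr_mult_self[of x "- \<alpha>" "- \<alpha> - 1"] powr_mult_self[of x "1 - \<alpha>" "- \<alpha>"] by simp
      finally show "norm (regular_part \<alpha> \<beta> x) \<le> K * x powr (1 - \<alpha>)" .
    qed simp
    from Lim_null_comparison[OF this lim]
    show ?thesis
      by (simp add: continuous_within True regular_part_def[abs_def])
  qed
qed

lemma regular_part_DERIV:
  fixes \<alpha> \<beta> x :: real
  assumes x: "0 < x" "x < 1"
  defines "p \<equiv> powr_taylor_rem \<beta>"
    and "p' \<equiv> \<lambda>x. \<beta> - \<beta> * (1 - x) powr (\<beta> - 1)"
    and "p'' \<equiv> \<lambda>x. \<beta> * (\<beta> - 1) * (1 - x) powr (\<beta> - 2)"
  shows "(regular_part \<alpha> \<beta> has_real_derivative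
      (- \<alpha> - 1) * x powr (- \<alpha> - 2) * p x + x powr (- \<alpha> - 1) * p' x) (at x)"
    and "((\<lambda>x. (- \<alpha> - 1) * x powr (- \<alpha> - 2) * p x + x powr (- \<alpha> - 1) * p' x) has_real_derivative
      (\<alpha> + 1) * (\<alpha> + 2) * x powr (- \<alpha> - 3) * p x - 2 * (\<alpha> + 1) * x powr (- \<alpha> - 2) * p' x
      + x powr (- \<alpha> - 1) * p'' x) (at x)"
proof -
  have D: "(p has_real_derivative p' x) (at x)" "(p' has_real_derivative p'' x) (at x)"
    unfolding p_def p'_def p''_def using powr_taylor_rem_DERIV[OF x(2)] by auto
  have e: "- \<alpha> - 1 - 1 = - \<alpha> - 2" "- \<alpha> - 2 - 1 = - \<alpha> - 3" by auto
  note P = has_real_derivative_powr[OF x(1), of "- \<alpha> - 1", unfolded e]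
    has_real_derivative_powr[OF x(1), of "- \<alpha> - 2", unfolded e]
  show "(regular_part \<alpha> \<beta> has_real_derivative
      (- \<alpha> - 1) * x powr (- \<alpha> - 2) * p x + x powr (- \<alpha> - 1) * p' x) (at x)"
    unfolding regular_part_def[abs_def] p_def[symmetric]
    by (rule DERIV_cong[OF DERIV_mult[OF P(1) D(1)]]) (simp add: p'_def algebra_simps)
  show "((\<lambda>x. (- \<alpha> - 1) * x powr (- \<alpha> - 2) * p x + x powr (- \<alpha> - 1) * p' x) has_real_derivative
      (\<alpha> + 1) * (\<alpha> + 2) * x powr (- \<alpha> - 3) * p x - 2 * (\<alpha> + 1) * x powr (- \<alpha> - 2) * p' x
      + x powr (- \<alpha> - 1) * p'' x) (at x)"
    by (rule DERIV_cong[OF DERIV_add[OF DERIV_mult[OF DERIV_cmult[OF P(2)] D(1)] DERIV_mult[OF P(1) D(2)]]])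
       (simp add: algebra_simps)
qed

text \<open>Each missing power of \<open>x\<close> is supplied by the Taylor bounds, so all three
  terms have order \<open>x powr (- \<alpha> - 1)\<close>. The factor 48 is
  \<open>4 * (6 + 4 + 2)\<close>.\<close>

lemma regular_part_DERIV2_bound_left:
  fixes \<alpha> \<beta> c x :: real
  assumes \<alpha>: "0 < \<alpha>" "\<alpha> < 1" and \<beta>: "\<beta> > 0" and c: "\<bar>c\<bar> \<le> 1" and x: "0 < x" "x \<le> 1 / 2"
  shows "\<bar>(\<alpha> + 1) * (\<alpha> + 2) * x powr (- \<alpha> - 3) * powr_taylor_rem \<beta> x
      - 2 * (\<alpha> + 1) * x powr (- \<alpha> - 2) * (\<beta> - \<beta> * (1 - x) powr (\<beta> - 1))
      + (x powr (- \<alpha> - 1) - c) * (\<beta> * (\<beta> - 1) * (1 - x) powr (\<beta> - 2))\<bar>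
    \<le> 48 * \<bar>\<beta> * (\<beta> - 1)\<bar> * x powr (- \<alpha> - 1)"
proof -
  define K where "K = 4 * \<bar>\<beta> * (\<beta> - 1)\<bar>"
  define X where "X = x powr (- \<alpha> - 1)"
  note bnd = powr_taylor_rem_bounds[OF \<beta>, of x, folded K_def]
  have K: "K \<ge> 0" by (simp add: K_def)
  have X: "x powr (- \<alpha> - 3) * x\<^sup>2 = X" "x powr (- \<alpha> - 2) * x = X"
    using x powr_mult_self[of x "- \<alpha> - 2" "- \<alpha> - 3"] powr_mult_self[of x "- \<alpha> - 1" "- \<alpha> - 2"]
    by (simp_all add: X_def power2_eq_square flip: mult.assoc)
  have "x powr 0 \<le> X" unfolding X_def using x \<alpha> by (intro powr_mono') auto
  then have X1: "1 \<le> X" using x by simp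
  have "\<bar>(\<alpha> + 1) * (\<alpha> + 2) * x powr (- \<alpha> - 3) * powr_taylor_rem \<beta> x\<bar>
      \<le> 2 * 3 * x powr (- \<alpha> - 3) * (K * x\<^sup>2)"
    unfolding abs_mult using \<alpha> bnd x by (intro mult_mono) auto
  also have "\<dots> = 6 * K * (x powr (- \<alpha> - 3) * x\<^sup>2)" by simp
  also have "x powr (- \<alpha> - 3) * x\<^sup>2 = X" by (rule X)
  finally have 1: "\<bar>(\<alpha> + 1) * (\<alpha> + 2) * x powr (- \<alpha> - 3) * powr_taylor_rem \<beta> x\<bar> \<le> 6 * K * X" .
  have "\<bar>2 * (\<alpha> + 1) * x powr (- \<alpha> - 2) * (\<beta> - \<beta> * (1 - x) powr (\<beta> - 1))\<bar>
      \<le> 2 * 2 * x powr (- \<alpha> - 2) * (K * x)"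
    unfolding abs_mult using \<alpha> bnd x by (intro mult_mono) auto
  also have "\<dots> = 4 * K * (x powr (- \<alpha> - 2) * x)" by simp
  also have "x powr (- \<alpha> - 2) * x = X" by (rule X)
  finally have 2: "\<bar>2 * (\<alpha> + 1) * x powr (- \<alpha> - 2) * (\<beta> - \<beta> * (1 - x) powr (\<beta> - 1))\<bar> \<le> 4 * K * X" .
  have "\<bar>(X - c) * (\<beta> * (\<beta> - 1) * (1 - x) powr (\<beta> - 2))\<bar> \<le> (2 * X) * K"
    unfolding abs_mult[of "X - c"] using bnd x c X1 by (intro mult_mono) auto
  moreover have "48 * \<bar>\<beta> * (\<beta> - 1)\<bar> * X = 6 * K * X + 4 * K * X + (2 * X) * K"
    by (simp add: K_def)
  ultimately show ?thesis
    unfolding X_def[symmetric] using 1 2 by linarith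
qed

text \<open>Near 1 the dangerous factor is \<open>(1 - x) powr (\<beta> - 2)\<close>. For
  \<open>c = 0\<close> it is harmless since \<open>\<beta> - 2 \<ge> - \<alpha> - 1\<close>; for
  \<open>c = 1\<close> its coefficient \<open>x powr (- \<alpha> - 1) - 1\<close> vanishes at 1 and
  supplies one more power of \<open>1 - x\<close>.\<close>

lemma regular_part_DERIV2_bound_right:
  fixes \<alpha> \<beta> c x :: real
  assumes \<alpha>: "0 < \<alpha>" "\<alpha> < 1" and \<beta>: "\<beta> > 0" and c: "c = 1 \<or> c = 0 \<and> \<beta> \<ge> 1 - \<alpha>"
    and x: "1 / 2 \<le> x" "x < 1"
  shows "\<bar>(\<alpha> + 1) * (\<alpha> + 2) * x powr (- \<alpha> - 3) * powr_taylor_rem \<beta> x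
      - 2 * (\<alpha> + 1) * x powr (- \<alpha> - 2) * (\<beta> - \<beta> * (1 - x) powr (\<beta> - 1))
      + (x powr (- \<alpha> - 1) - c) * (\<beta> * (\<beta> - 1) * (1 - x) powr (\<beta> - 2))\<bar>
    \<le> (96 * (2 + \<beta>) + 128 * \<beta> + 32 * \<bar>\<beta> * (\<beta> - 1)\<bar>) * (1 - x) powr (- \<alpha> - 1)"
proof -
  define u where "u = 1 - x"
  define U where "U = u powr (- \<alpha> - 1)"
  have u: "0 < u" "u \<le> 1 / 2" using x by (auto simp: u_def)
  have "u powr 0 \<le> U" unfolding U_def using u \<alpha> by (intro powr_mono') auto
  then have U1: "1 \<le> U" using u by simp
  have up1: "u powr (\<beta> - 1) \<le> U"
    unfolding U_def using u \<alpha> \<beta> by (intro powr_mono') auto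
  \<comment> \<open>One bound, \<open>(1 / 2) powr (- 4)\<close>, for all negative powers of
    \<open>x\<close> that occur.\<close>
  have xp: "x powr a \<le> 16" if "- 4 \<le> a" "a \<le> 0" for a
  proof -
    have "x powr a \<le> (1 / 2) powr a" using x that by (intro powr_mono2') auto
    also have "\<dots> \<le> (1 / 2) powr (- 4)" using that by (intro powr_mono') auto
    also have "\<dots> = (16 :: real)" by (simp add: powr_minus powr_divide)
    finally show ?thesis .
  qed
  have "\<bar>powr_taylor_rem \<beta> x\<bar> \<le> 2 + \<beta>"
  proof -
    have "u powr \<beta> \<le> 1" "0 \<le> u powr \<beta>" using u \<beta> powr_le1[of \<beta> u] by auto
    moreover have "\<beta> * x \<le> \<beta>" "0 \<le> \<beta> * x" using x \<beta> by auto
    ultimately show ?thesis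
      unfolding powr_taylor_rem_def u_def[symmetric] abs_le_iff using \<beta> by linarith
  qed
  also have "\<dots> \<le> (2 + \<beta>) * U" using \<beta> U1 by simp
  finally have p: "\<bar>powr_taylor_rem \<beta> x\<bar> \<le> (2 + \<beta>) * U" .
  have p': "\<bar>\<beta> - \<beta> * u powr (\<beta> - 1)\<bar> \<le> \<beta> * (2 * U)"
  proof -
    have "\<bar>1 - u powr (\<beta> - 1)\<bar> \<le> 2 * U"
      using up1 U1 powr_ge_zero[of u "\<beta> - 1"] unfolding abs_le_iff by linarith
    then have "\<beta> * \<bar>1 - u powr (\<beta> - 1)\<bar> \<le> \<beta> * (2 * U)"
      using \<beta> by (intro mult_left_mono) auto
    also have "\<beta> * \<bar>1 - u powr (\<beta> - 1)\<bar> = \<bar>\<beta> * (1 - u powr (\<beta> - 1))\<bar>"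
      using \<beta> by (simp add: abs_mult)
    finally show ?thesis by (simp add: right_diff_distrib)
  qed
  have p'': "\<bar>x powr (- \<alpha> - 1) - c\<bar> * u powr (\<beta> - 2) \<le> 32 * U"
    using c
  proof
    assume c: "c = 0 \<and> \<beta> \<ge> 1 - \<alpha>"
    then have "u powr (\<beta> - 2) \<le> U"
      unfolding U_def using u by (intro powr_mono') auto
    then have "\<bar>x powr (- \<alpha> - 1) - c\<bar> * u powr (\<beta> - 2) \<le> 16 * U"
      using xp[of "- \<alpha> - 1"] \<alpha> c by (intro mult_mono) (auto simp: algebra_simps)
    then show ?thesis using U1 by simp
  next
    assume c: "c = 1"
    have "norm (1 powr (- \<alpha> - 1) - x powr (- \<alpha> - 1)) \<le> 32 * norm (1 - x)"
    proof (rule field_differentiable_bound[of "{1/2..1}" "\<lambda>x. x powr (- \<alpha> - 1)" "\<lambda>x. (- \<alpha> - 1) * x powr (- \<alpha> - 2)"])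
      fix z :: real assume z: "z \<in> {1/2..1}"
      then have z0: "z > 0" by auto
      have e: "- \<alpha> - 1 - 1 = - \<alpha> - 2" by simp
      show "((\<lambda>x. x powr (- \<alpha> - 1)) has_real_derivative (- \<alpha> - 1) * z powr (- \<alpha> - 2)) (at z within {1/2..1})"
        by (rule has_field_derivative_at_within[OF has_real_derivative_powr[OF z0, of "- \<alpha> - 1", unfolded e]])
      have "z powr (- \<alpha> - 2) \<le> (1 / 2) powr (- \<alpha> - 2)" using z \<alpha> by (intro powr_mono2') auto
      also have "\<dots> \<le> (1 / 2) powr (- 4)" using \<alpha> by (intro powr_mono') auto
      also have "\<dots> = (16 :: real)" by (simp add: powr_minus powr_divide)
      finally show "norm ((- \<alpha> - 1) * z powr (- \<alpha> - 2)) \<le> 32"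
        using \<alpha> mult_mono[of "\<bar>- \<alpha> - 1\<bar>" 2 "z powr (- \<alpha> - 2)" 16] by (simp add: abs_mult)
    qed (use x in auto)
    then have "\<bar>x powr (- \<alpha> - 1) - c\<bar> \<le> 32 * u"
      using x c by (simp add: u_def abs_minus_commute)
    from mult_right_mono[OF this, of "u powr (\<beta> - 2)"]
    have "\<bar>x powr (- \<alpha> - 1) - c\<bar> * u powr (\<beta> - 2) \<le> 32 * (u powr (\<beta> - 2) * u)"
      by (simp add: mult_ac)
    also have "u powr (\<beta> - 2) * u = u powr (\<beta> - 1)"
      using u by (intro powr_mult_self) auto
    finally show ?thesis using up1 by simp
  qed
  have 1: "\<bar>(\<alpha> + 1) * (\<alpha> + 2) * x powr (- \<alpha> - 3) * powr_taylor_rem \<beta> x\<bar> \<le> 2 * 3 * 16 * ((2 + \<beta>) * U)"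
    unfolding abs_mult using \<alpha> p xp[of "- \<alpha> - 3"] by (intro mult_mono) (auto simp: algebra_simps)
  have 2: "\<bar>2 * (\<alpha> + 1) * x powr (- \<alpha> - 2) * (\<beta> - \<beta> * u powr (\<beta> - 1))\<bar> \<le> 2 * 2 * 16 * (\<beta> * (2 * U))"
    unfolding abs_mult[of _ "\<beta> - _"] abs_mult[of _ "x powr _"] abs_mult[of 2]
    using \<alpha> p' xp[of "- \<alpha> - 2"] by (intro mult_mono) (auto simp: algebra_simps)
  have 3: "\<bar>(x powr (- \<alpha> - 1) - c) * (\<beta> * (\<beta> - 1) * u powr (\<beta> - 2))\<bar> \<le> \<bar>\<beta> * (\<beta> - 1)\<bar> * (32 * U)"
    using mult_left_mono[OF p'', of "\<bar>\<beta> * (\<beta> - 1)\<bar>"] by (simp add: abs_mult mult_ac)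
  have "(96 * (2 + \<beta>) + 128 * \<beta> + 32 * \<bar>\<beta> * (\<beta> - 1)\<bar>) * U =
      2 * 3 * 16 * ((2 + \<beta>) * U) + 2 * 2 * 16 * (\<beta> * (2 * U)) + \<bar>\<beta> * (\<beta> - 1)\<bar> * (32 * U)"
    by (simp add: algebra_simps)
  then show ?thesis
    unfolding u_def[symmetric] U_def[symmetric] using 1 2 3 by linarith
qed

text \<open>\<open>c\<close> switches the subtraction of \<open>(1 - x) powr \<beta>\<close> on or
  off. The two half-interval bounds give the hypothesis of \<open>trapezoid_error_bound\<close> with
  \<open>M = M1 + M2\<close>.\<close>

lemma trapezoid_error_regular_part:
  assumes \<alpha>: "0 < \<alpha>" "\<alpha> < 1" and \<beta>: "\<beta> > 0" and c: "c = 1 \<or> c = 0 \<and> \<beta> \<ge> 1 - \<alpha>"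
  shows "\<exists>C. \<forall>n\<ge>1. \<bar>trapezoid_error (\<lambda>x. regular_part \<alpha> \<beta> x - c * (1 - x) powr \<beta>) n\<bar>
           \<le> C * real n powr (\<alpha> - 1)"
proof -
  define p' where "p' = (\<lambda>x. \<beta> - \<beta> * (1 - x) powr (\<beta> - 1))"
  define p'' where "p'' = (\<lambda>x. \<beta> * (\<beta> - 1) * (1 - x) powr (\<beta> - 2))"
  define g' where "g' = (\<lambda>x. (- \<alpha> - 1) * x powr (- \<alpha> - 2) * powr_taylor_rem \<beta> x
      + x powr (- \<alpha> - 1) * p' x - c * (p' x - \<beta>))"
  define g'' where "g'' = (\<lambda>x. (\<alpha> + 1) * (\<alpha> + 2) * x powr (- \<alpha> - 3) * powr_taylor_rem \<beta> x
      - 2 * (\<alpha> + 1) * x powr (- \<alpha> - 2) * p' x + x powr (- \<alpha> - 1) * p'' x - c * p'' x)"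
  define M1 where "M1 = 48 * \<bar>\<beta> * (\<beta> - 1)\<bar>"
  define M2 where "M2 = 96 * (2 + \<beta>) + 128 * \<beta> + 32 * \<bar>\<beta> * (\<beta> - 1)\<bar>"
  show ?thesis
  proof (rule trapezoid_error_bound[OF \<alpha>, of _ g' g'' "M1 + M2"])
    show "continuous_on {0..1} (\<lambda>x. regular_part \<alpha> \<beta> x - c * (1 - x) powr \<beta>)"
      by (intro continuous_on_diff continuous_on_mult_left continuous_on_regular_part \<alpha> \<beta>
          continuous_on_powr_unit)
    fix x :: real assume x: "0 < x" "x < 1"
    have "((\<lambda>x. (1 - x) powr \<beta>) has_real_derivative p' x - \<beta>) (at x)"
      unfolding p'_def using x by (auto intro!: derivative_eq_intros)
    from DERIV_diff[OF regular_part_DERIV(1)[OF x, of \<alpha> \<beta>] DERIV_cmult[OF this, of c]]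
    show "((\<lambda>x. regular_part \<alpha> \<beta> x - c * (1 - x) powr \<beta>) has_real_derivative g' x) (at x)"
      unfolding g'_def p'_def .
    have "(p' has_real_derivative p'' x) (at x)"
      unfolding p'_def p''_def using powr_taylor_rem_DERIV(2)[OF x(2)] .
    then have "((\<lambda>x. p' x - \<beta>) has_real_derivative p'' x) (at x)"
      by (auto intro!: derivative_eq_intros)
    from DERIV_diff[OF regular_part_DERIV(2)[OF x, of \<alpha> \<beta>] DERIV_cmult[OF this, of c]]
    show "(g' has_real_derivative g'' x) (at x)"
      unfolding g'_def g''_def p'_def p''_def .
    define L where "L = x powr (- \<alpha> - 1)"
    define R where "R = (1 - x) powr (- \<alpha> - 1)"
    have LR: "L \<ge> 0" "R \<ge> 0" "M1 \<ge> 0" "M2 \<ge> 0" using \<beta> by (auto simp: L_def R_def M1_def M2_def)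
    have g'': "g'' x = (\<alpha> + 1) * (\<alpha> + 2) * x powr (- \<alpha> - 3) * powr_taylor_rem \<beta> x
      - 2 * (\<alpha> + 1) * x powr (- \<alpha> - 2) * (\<beta> - \<beta> * (1 - x) powr (\<beta> - 1))
      + (x powr (- \<alpha> - 1) - c) * (\<beta> * (\<beta> - 1) * (1 - x) powr (\<beta> - 2))"
      unfolding g''_def p'_def p''_def by (simp add: left_diff_distrib)
    have "\<bar>g'' x\<bar> \<le> M1 * L \<or> \<bar>g'' x\<bar> \<le> M2 * R"
      using regular_part_DERIV2_bound_left[OF \<alpha> \<beta>, of c x] regular_part_DERIV2_bound_right[OF \<alpha> \<beta> c, of x] x c
      unfolding g'' L_def R_def M1_def M2_def by (cases "x \<le> 1 / 2") auto
    moreover have "(M1 + M2) * (L + R) = M1 * L + M2 * R + (M1 * R + M2 * L)"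
      by (simp add: algebra_simps)
    moreover have "M1 * L \<ge> 0" "M1 * R \<ge> 0" "M2 * L \<ge> 0" "M2 * R \<ge> 0" using LR by auto
    ultimately show "\<bar>g'' x\<bar> \<le> (M1 + M2) * (x powr (- \<alpha> - 1) + (1 - x) powr (- \<alpha> - 1))"
      unfolding L_def[symmetric] R_def[symmetric] by linarith
  qed
qed

text \<open>Integration by parts lowers the singularity to \<open>x powr (- \<alpha>)\<close>,
  leaving a convergent Beta integral. The terms
  \<open>1 / \<alpha> + \<beta> / (1 - \<alpha>)\<close> later cancel against the partial sums of
  the singular terms.\<close>

lemma has_integral_regular_part:
  assumes \<alpha>: "0 < \<alpha>" "\<alpha> < 1" and \<beta>: "\<beta> > 0"
  shows "(regular_part \<alpha> \<beta> has_integral 1 / \<alpha> + \<beta> / (1 - \<alpha>) - \<beta> / \<alpha> * Beta (1 - \<alpha>) \<beta>) {0..1}"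
proof -
  \<comment> \<open>Equals \<open>- (1 / \<alpha>) * x powr (- \<alpha>)\<close> times the Taylor
    remainder for \<open>x > 0\<close>; in this form continuity at 0 is inherited from
    \<open>regular_part\<close>.\<close>
  define \<Phi> where "\<Phi> = (\<lambda>x. - (1 / \<alpha>) * (x * regular_part \<alpha> \<beta> x))"
  have "((\<lambda>x. regular_part \<alpha> \<beta> x - \<beta> / \<alpha> * (x powr (- \<alpha>) - x powr (- \<alpha>) * (1 - x) powr (\<beta> - 1)))
      has_integral (\<Phi> 1 - \<Phi> 0)) {0..1}"
  proof (rule fundamental_theorem_of_calculus_interior)
    show "continuous_on {0..1} \<Phi>"
      unfolding \<Phi>_def by (intro continuous_intros continuous_on_regular_part \<alpha> \<beta>)
    fix x :: real assume "x \<in> {0<..<1}"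
    then have x: "0 < x" "x < 1" by auto
    define X where "X = x powr (- \<alpha> - 2)"
    have X: "x powr (- \<alpha> - 1) = X * x" "x powr (- \<alpha>) = X * x * x"
      using x powr_mult_self[of x "- \<alpha> - 1" "- \<alpha> - 2"] powr_mult_self[of x "- \<alpha>" "- \<alpha> - 1"] by (auto simp: X_def)
    have "(\<Phi> has_real_derivative - (1 / \<alpha>) * (1 * regular_part \<alpha> \<beta> x + 
        ((- \<alpha> - 1) * x powr (- \<alpha> - 2) * powr_taylor_rem \<beta> x
          + x powr (- \<alpha> - 1) * (\<beta> - \<beta> * (1 - x) powr (\<beta> - 1))) * x)) (at x)"
      unfolding \<Phi>_def by (intro DERIV_cmult DERIV_mult DERIV_ident regular_part_DERIV x)
    also have "- (1 / \<alpha>) * (1 * regular_part \<alpha> \<beta> x + 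
        ((- \<alpha> - 1) * x powr (- \<alpha> - 2) * powr_taylor_rem \<beta> x
          + x powr (- \<alpha> - 1) * (\<beta> - \<beta> * (1 - x) powr (\<beta> - 1))) * x) =
        regular_part \<alpha> \<beta> x - \<beta> / \<alpha> * (x powr (- \<alpha>) - x powr (- \<alpha>) * (1 - x) powr (\<beta> - 1))"
      unfolding regular_part_def X X_def[symmetric] using \<alpha> by (simp add: field_simps)
    finally show "(\<Phi> has_vector_derivative
        regular_part \<alpha> \<beta> x - \<beta> / \<alpha> * (x powr (- \<alpha>) - x powr (- \<alpha>) * (1 - x) powr (\<beta> - 1))) (at x)"
      by (simp add: has_real_derivative_iff_has_vector_derivative)
  qed simp
  moreover have "((\<lambda>x. \<beta> / \<alpha> * (x powr (- \<alpha>) - x powr (- \<alpha>) * (1 - x) powr (\<beta> - 1))) has_integral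
      \<beta> / \<alpha> * (1 / (1 - \<alpha>) - Beta (1 - \<alpha>) \<beta>)) {0..1}"
    using has_integral_powr_unit(1)[of "- \<alpha>"] has_integral_Beta_real[of "1 - \<alpha>" \<beta>] \<alpha> \<beta>
    by (intro has_integral_mult_right has_integral_diff) auto
  ultimately have "(regular_part \<alpha> \<beta> has_integral
      (\<Phi> 1 - \<Phi> 0) + \<beta> / \<alpha> * (1 / (1 - \<alpha>) - Beta (1 - \<alpha>) \<beta>)) {0..1}"
    by (rule has_integral_add[THEN has_integral_eq_rhs, THEN has_integral_eq[rotated]]) simp_all
  also have "(\<Phi> 1 - \<Phi> 0) + \<beta> / \<alpha> * (1 / (1 - \<alpha>) - Beta (1 - \<alpha>) \<beta>) =
      1 / \<alpha> + \<beta> / (1 - \<alpha>) - \<beta> / \<alpha> * Beta (1 - \<alpha>) \<beta>"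
    using \<alpha> by (simp add: \<Phi>_def regular_part_def powr_taylor_rem_def field_simps)
  finally show ?thesis .
qed

section \<open>Asymptotics of the convolution sum\<close>

text \<open>If \<open>\<beta> \<ge> 1 - \<alpha>\<close>, the \<open>\<zeta>(-\<beta>)\<close> term is itself within the error bound; otherwise it comes from
  the part \<open>(1 - x)\<^sup>\<beta>\<close>, whose removal makes the remainder regular enough at \<open>1\<close>.\<close>

lemma trapezoid_error_regular_part_asymp:
  assumes \<alpha>: "0 < \<alpha>" "\<alpha> < 1" and \<beta>: "\<beta> > 0"
  shows "\<exists>C. \<forall>n\<ge>1. \<bar>trapezoid_error (regular_part \<alpha> \<beta>) n - zeta_real (- \<beta>) * real n powr (- \<beta>)\<bar>
           \<le> C * real n powr (\<alpha> - 1)"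
proof (cases "\<beta> \<ge> 1 - \<alpha>")
  case True
  obtain C where C: "\<And>n. n \<ge> 1 \<Longrightarrow> \<bar>trapezoid_error (regular_part \<alpha> \<beta>) n\<bar> \<le> C * real n powr (\<alpha> - 1)"
    using trapezoid_error_regular_part[OF \<alpha> \<beta>, of 0] True by auto
  show ?thesis
  proof (intro exI[of _ "C + \<bar>zeta_real (- \<beta>)\<bar>"] allI impI)
    fix n :: nat assume n: "n \<ge> 1"
    have "\<bar>zeta_real (- \<beta>) * real n powr (- \<beta>)\<bar> \<le> \<bar>zeta_real (- \<beta>)\<bar> * real n powr (\<alpha> - 1)"
      unfolding abs_mult using n True by (intro mult_left_mono) (auto intro!: powr_mono)
    with C[OF n] show "\<bar>trapezoid_error (regular_part \<alpha> \<beta>) n - zeta_real (- \<beta>) * real n powr (- \<beta>)\<bar>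
        \<le> (C + \<bar>zeta_real (- \<beta>)\<bar>) * real n powr (\<alpha> - 1)"
      unfolding distrib_right by linarith
  qed
next
  case False
  then have \<beta>1: "\<beta> < 1" using \<alpha> by simp
  obtain C where C: "\<And>n. n \<ge> 1 \<Longrightarrow>
      \<bar>trapezoid_error (\<lambda>x. regular_part \<alpha> \<beta> x - (1 - x) powr \<beta>) n\<bar> \<le> C * real n powr (\<alpha> - 1)"
    using trapezoid_error_regular_part[OF \<alpha> \<beta>, of 1] by auto
  obtain D where D: "\<And>n. n \<ge> 1 \<Longrightarrow>
      \<bar>trapezoid_error (\<lambda>x. x powr \<beta>) n - zeta_real (- \<beta>) * real n powr (- \<beta>)\<bar> \<le> D / real n"
    using trapezoid_error_powr_asymp[OF \<beta> \<beta>1] by auto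
  show ?thesis
  proof (intro exI[of _ "C + \<bar>D\<bar>"] allI impI)
    fix n :: nat assume n: "n \<ge> 1"
    \<comment> \<open>By reflection, \<open>(1 - x) powr \<beta>\<close> and
      \<open>x powr \<beta>\<close> have the same trapezoidal error.\<close>
    have eq: "trapezoid_error (\<lambda>x. regular_part \<alpha> \<beta> x - (1 - x) powr \<beta>) n =
        trapezoid_error (regular_part \<alpha> \<beta>) n - trapezoid_error (\<lambda>x. x powr \<beta>) n"
      unfolding trapezoid_error_powr(2)[OF \<beta> n, symmetric]
      by (intro trapezoid_error_diff continuous_on_regular_part \<alpha> \<beta> continuous_on_powr_unit)
    have "D / real n \<le> \<bar>D\<bar> * real n powr (- 1)"
      using n by (simp add: powr_minus_divide divide_right_mono)
    also have "\<dots> \<le> \<bar>D\<bar> * real n powr (\<alpha> - 1)"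
      using n \<alpha> by (intro mult_left_mono powr_mono) auto
    finally show "\<bar>trapezoid_error (regular_part \<alpha> \<beta>) n - zeta_real (- \<beta>) * real n powr (- \<beta>)\<bar>
        \<le> (C + \<bar>D\<bar>) * real n powr (\<alpha> - 1)"
      using C[OF n] D[OF n] unfolding eq distrib_right by linarith
  qed
qed

text \<open>At \<open>x = k / n\<close> the kernel \<open>(1 - x)^\<beta> x^(-\<alpha>-1)\<close> is
  the regular part plus \<open>x^(-\<alpha>-1) - \<beta> x^(-\<alpha>)\<close>, and all is scaled by
  \<open>n powr (- \<alpha> - 1)\<close>.\<close>

lemma convolution_sum_eq_trapezoid_error:
  assumes \<alpha>: "0 < \<alpha>" "\<alpha> < 1" and \<beta>: "\<beta> > 0" and n: "n \<ge> 1"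
  shows "(\<Sum>k=1..<n. (1 - real k / real n) powr \<beta> / real k powr (1 + \<alpha>)) =
     real n powr (- \<alpha> - 1) * (trapezoid_error (regular_part \<alpha> \<beta>) n - (\<beta> - 1) / 2
       + real n * (1 / \<alpha> + \<beta> / (1 - \<alpha>) - \<beta> / \<alpha> * Beta (1 - \<alpha>) \<beta>))
     + (\<Sum>k=1..<n. real k powr (- (1 + \<alpha>))) - \<beta> / real n * (\<Sum>k=1..<n. real k powr (- \<alpha>))"
proof -
  have "(1 - real k / real n) powr \<beta> / real k powr (1 + \<alpha>) =
      real n powr (- \<alpha> - 1) * regular_part \<alpha> \<beta> (real k / real n)
      + real k powr (- (1 + \<alpha>)) - \<beta> / real n * real k powr (- \<alpha>)" if "k \<in> {1..<n}" for k
  proof -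
    have k: "real k > 0" using that by simp
    have "real n powr (- \<alpha> - 1) * (real k / real n) powr (- \<alpha> - 1) = real k powr (- (1 + \<alpha>))"
    proof -
      have "- (1 + \<alpha>) = - \<alpha> - 1" by simp
      then show ?thesis using n k by (simp only: powr_divide) simp
    qed
    moreover have "real k powr (- \<alpha>) = real k powr (- (1 + \<alpha>)) * real k"
      using k by (intro powr_mult_self[symmetric]) auto
    ultimately have *: "real n powr (- \<alpha> - 1) * regular_part \<alpha> \<beta> (real k / real n)
      + real k powr (- (1 + \<alpha>)) - \<beta> / real n * real k powr (- \<alpha>) =
      real k powr (- (1 + \<alpha>)) * (1 - real k / real n) powr \<beta>"
      unfolding regular_part_def powr_taylor_rem_def by (simp add: algebra_simps)
    have "(1 - real k / real n) powr \<beta> / real k powr (1 + \<alpha>) =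
        real k powr (- (1 + \<alpha>)) * (1 - real k / real n) powr \<beta>"
      unfolding powr_minus_divide by simp
    then show ?thesis by (rule trans[OF _ *[symmetric]])
  qed
  then have "(\<Sum>k=1..<n. (1 - real k / real n) powr \<beta> / real k powr (1 + \<alpha>)) =
      real n powr (- \<alpha> - 1) * (\<Sum>k=1..<n. regular_part \<alpha> \<beta> (real k / real n))
      + (\<Sum>k=1..<n. real k powr (- (1 + \<alpha>))) - \<beta> / real n * (\<Sum>k=1..<n. real k powr (- \<alpha>))"
    by (simp add: sum.distrib sum_subtractf sum_distrib_left)
  \<comment> \<open>The regular part is 0 at 0 and \<open>\<beta> - 1\<close> at 1, so the endpoint
    correction is \<open>(\<beta> - 1) / 2\<close>.\<close>
  also have "(\<Sum>k=1..<n. regular_part \<alpha> \<beta> (real k / real n)) =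
      trapezoid_error (regular_part \<alpha> \<beta>) n - (\<beta> - 1) / 2
       + real n * (1 / \<alpha> + \<beta> / (1 - \<alpha>) - \<beta> / \<alpha> * Beta (1 - \<alpha>) \<beta>)"
    unfolding trapezoid_error_def integral_unique[OF has_integral_regular_part[OF \<alpha> \<beta>]]
    by (simp add: regular_part_def powr_taylor_rem_def)
  finally show ?thesis .
qed

text \<open>On inserting the expansions of both zeta sums, their integral terms cancel
  \<open>1 / \<alpha> + \<beta> / (1 - \<alpha>)\<close> and their half-terms cancel
  \<open>(\<beta> - 1) / 2\<close>. The three remaining errors are each
  \<open>O(n powr (- 2))\<close>.\<close>

lemma convolution_sum_asymp:
  assumes \<alpha>: "0 < \<alpha>" "\<alpha> < 1" and \<beta>: "\<beta> > 0"
  shows "\<exists>C. \<forall>n\<ge>1. \<bar>(\<Sum>k=1..<n. (1 - real k / real n) powr \<beta> / real k powr (1 + \<alpha>))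
      - zeta_real (1 + \<alpha>) + \<beta> * zeta_real \<alpha> / real n
      + \<beta> / \<alpha> * Beta (1 - \<alpha>) \<beta> * real n powr (- \<alpha>)
      - zeta_real (- \<beta>) * real n powr (- \<alpha> - 1 - \<beta>)\<bar> \<le> C * real n powr (- 2)"
proof -
  define T where "T = (\<lambda>n. trapezoid_error (regular_part \<alpha> \<beta>) n - zeta_real (- \<beta>) * real n powr (- \<beta>))"
  define e1 where "e1 = (\<lambda>n. (\<Sum>k=1..<n. real k powr (- (1 + \<alpha>))) - zeta_real (1 + \<alpha>)
      - real n powr (1 - (1 + \<alpha>)) / (1 - (1 + \<alpha>)) + real n powr (- (1 + \<alpha>)) / 2)"
  define e0 where "e0 = (\<lambda>n. (\<Sum>k=1..<n. real k powr (- \<alpha>)) - zeta_real \<alpha>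
      - real n powr (1 - \<alpha>) / (1 - \<alpha>) + real n powr (- \<alpha>) / 2)"
  obtain C where C: "\<And>n. n \<ge> 1 \<Longrightarrow> \<bar>T n\<bar> \<le> C * real n powr (\<alpha> - 1)"
    unfolding T_def using trapezoid_error_regular_part_asymp[OF \<alpha> \<beta>] by blast
  obtain C1 where C1: "\<And>n. n \<ge> 1 \<Longrightarrow> \<bar>e1 n\<bar> \<le> C1 * real n powr (- (1 + \<alpha>) - 1)"
    unfolding e1_def using zeta_real_partial_sum_bound[of "1 + \<alpha>"] \<alpha> by auto
  obtain C0 where C0: "\<And>n. n \<ge> 1 \<Longrightarrow> \<bar>e0 n\<bar> \<le> C0 * real n powr (- \<alpha> - 1)"
    unfolding e0_def using zeta_real_partial_sum_bound[of "\<alpha>"] \<alpha> by auto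
  show ?thesis
  proof (intro exI[of _ "C + \<bar>C1\<bar> + \<beta> * \<bar>C0\<bar>"] allI impI)
    fix n :: nat assume n: "n \<ge> 1"
    then have n0: "real n > 0" by simp
    define N where "N = real n powr (- \<alpha> - 1)"
    have N: "real n powr (- (1 + \<alpha>)) = N" "real n powr (- \<alpha>) = N * real n"
      "real n powr (1 - (1 + \<alpha>)) = N * real n" "real n powr (1 - \<alpha>) = N * real n * real n"
      "real n powr (- \<alpha> - 1 - \<beta>) = N * real n powr (- \<beta>)"
    proof -
      have "- \<alpha> - 1 - \<beta> = (- \<alpha> - 1) + (- \<beta>)" by simp
      then show "real n powr (- \<alpha> - 1 - \<beta>) = N * real n powr (- \<beta>)"
        unfolding N_def by (simp only: powr_add)
      show *: "real n powr (- \<alpha>) = N * real n" "real n powr (1 - (1 + \<alpha>)) = N * real n"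
        unfolding N_def by (rule powr_mult_self[symmetric]; simp)+
      show "real n powr (1 - \<alpha>) = N * real n * real n"
        unfolding *(1)[symmetric] by (rule powr_mult_self[symmetric]; simp)
      show "real n powr (- (1 + \<alpha>)) = N"
        unfolding N_def by (rule arg_cong[of _ _ "(powr) (real n)"]) simp
    qed
    have e1: "(\<Sum>k=1..<n. real k powr (- (1 + \<alpha>))) = e1 n + zeta_real (1 + \<alpha>) - N * real n / \<alpha> - N / 2"
      unfolding e1_def N by simp
    have e0: "(\<Sum>k=1..<n. real k powr (- \<alpha>)) = e0 n + zeta_real \<alpha> + N * real n * real n / (1 - \<alpha>) - N * real n / 2"
      unfolding e0_def N by simp
    define Q where "Q = 1 / (1 - \<alpha>)"
    define Q' where "Q' = 1 / \<alpha>"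
    have eq: "(\<Sum>k=1..<n. (1 - real k / real n) powr \<beta> / real k powr (1 + \<alpha>))
        - zeta_real (1 + \<alpha>) + \<beta> * zeta_real \<alpha> / real n
        + \<beta> / \<alpha> * Beta (1 - \<alpha>) \<beta> * real n powr (- \<alpha>)
        - zeta_real (- \<beta>) * real n powr (- \<alpha> - 1 - \<beta>) = N * T n + e1 n - \<beta> * e0 n / real n"
    proof -
      have a: "x / (1 - \<alpha>) = x * Q" "x / \<alpha> = x * Q'" for x by (simp_all add: Q_def Q'_def)
      show ?thesis
        unfolding convolution_sum_eq_trapezoid_error[OF \<alpha> \<beta> n] e1 e0 N N_def[symmetric] T_def a
        using n0 by (simp add: field_simps)
    qed
    have "N * \<bar>T n\<bar> \<le> N * (C * real n powr (\<alpha> - 1))"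
      using C[OF n] by (intro mult_left_mono) (auto simp: N_def)
    also have "\<dots> = C * (N * real n powr (\<alpha> - 1))" by (rule mult.left_commute)
    also have "N * real n powr (\<alpha> - 1) = real n powr (- 2)"
      unfolding N_def powr_add[symmetric] by simp
    finally have 1: "\<bar>N * T n\<bar> \<le> C * real n powr (- 2)"
      by (simp add: abs_mult N_def)
    have "\<bar>e1 n\<bar> \<le> C1 * real n powr (- (1 + \<alpha>) - 1)" by (rule C1[OF n])
    also have "\<dots> \<le> \<bar>C1\<bar> * real n powr (- 2)"
      using n \<alpha> by (intro mult_mono powr_mono) auto
    finally have 2: "\<bar>e1 n\<bar> \<le> \<bar>C1\<bar> * real n powr (- 2)" .
    have "\<bar>\<beta> * e0 n / real n\<bar> = \<beta> / real n * \<bar>e0 n\<bar>"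
      using \<beta> by (simp add: abs_mult)
    also have "\<dots> \<le> \<beta> / real n * (\<bar>C0\<bar> * real n powr (- 1))"
    proof (intro mult_left_mono)
      have "\<bar>e0 n\<bar> \<le> C0 * real n powr (- \<alpha> - 1)" by (rule C0[OF n])
      also have "\<dots> \<le> \<bar>C0\<bar> * real n powr (- 1)"
        using n \<alpha> by (intro mult_mono powr_mono) auto
      finally show "\<bar>e0 n\<bar> \<le> \<bar>C0\<bar> * real n powr (- 1)" .
    qed (use \<beta> in auto)
    also have "\<dots> = \<beta> * \<bar>C0\<bar> * real n powr (- 2)"
      using n0 by (simp add: powr_minus_divide power2_eq_square)
    finally have 3: "\<bar>\<beta> * e0 n / real n\<bar> \<le> \<beta> * \<bar>C0\<bar> * real n powr (- 2)" .
    show "\<bar>(\<Sum>k=1..<n. (1 - real k / real n) powr \<beta> / real k powr (1 + \<alpha>))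
      - zeta_real (1 + \<alpha>) + \<beta> * zeta_real \<alpha> / real n
      + \<beta> / \<alpha> * Beta (1 - \<alpha>) \<beta> * real n powr (- \<alpha>)
      - zeta_real (- \<beta>) * real n powr (- \<alpha> - 1 - \<beta>)\<bar> \<le> (C + \<bar>C1\<bar> + \<beta> * \<bar>C0\<bar>) * real n powr (- 2)"
      unfolding eq distrib_right using 1 2 3 by linarith
  qed
qed

section \<open>Caputo derivative of a power and the final expansion\<close>

lemma deriv_powr_on_nonneg:
  fixes \<beta> x :: real and y :: "real \<Rightarrow> real"
  assumes y: "\<And>x. x \<ge> 0 \<Longrightarrow> y x = x powr \<beta>" and x: "x > 0"
  shows "deriv y x = \<beta> * x powr (\<beta> - 1)"
proof -
  have "\<forall>\<^sub>F z in nhds x. y z = z powr \<beta>"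
    using eventually_nhds_in_open[of "{0<..}" x] x y by (auto elim!: eventually_mono)
  then have "deriv y x = deriv (\<lambda>z. z powr \<beta>) x"
    by (rule deriv_cong_ev) simp
  also have "\<dots> = \<beta> * x powr (\<beta> - 1)"
    by (rule DERIV_imp_deriv[OF has_real_derivative_powr[OF x]])
  finally show ?thesis .
qed

text \<open>Scaling the variable by \<open>t\<close> gives a Beta integral. Passing from
  \<open>Gamma (1 - \<alpha>)\<close> to \<open>Gamma (- \<alpha>)\<close> matches the
  \<open>n powr (- \<alpha>)\<close> term of the convolution sum.\<close>

lemma caputo_deriv_powr:
  fixes \<alpha> \<beta> t :: real and y :: "real \<Rightarrow> real"
  assumes \<alpha>: "0 < \<alpha>" "\<alpha> < 1" and \<beta>: "\<beta> > 0" and t: "t > 0"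
    and y: "\<And>x. x \<ge> 0 \<Longrightarrow> y x = x powr \<beta>"
  shows "caputo_deriv \<alpha> y t = - (\<beta> / \<alpha>) * Beta (1 - \<alpha>) \<beta> * t powr (\<beta> - \<alpha>) / Gamma (- \<alpha>)"
proof -
  have "((\<lambda>x. x powr (\<beta> - 1) * (1 - x) powr ((1 - \<alpha>) - 1)) has_integral Beta \<beta> (1 - \<alpha>)) (cbox 0 1)"
    using has_integral_Beta_real[of \<beta> "1 - \<alpha>"] \<alpha> \<beta> by simp
  from has_integral_affinity[OF this, of "1 / t" 0]
  have "((\<lambda>x. (x / t) powr (\<beta> - 1) * (1 - x / t) powr (- \<alpha>)) has_integral t * Beta \<beta> (1 - \<alpha>)) ((\<lambda>x. t * x) ` cbox 0 1)"
    using t by simp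
  also have "(\<lambda>x. t * x) ` cbox 0 1 = {0..t}"
    using t image_mult_atLeastAtMost[of t 0 1] by simp
  finally have "((\<lambda>x. \<beta> * t powr (\<beta> - \<alpha> - 1) * ((x / t) powr (\<beta> - 1) * (1 - x / t) powr (- \<alpha>)))
      has_integral \<beta> * t powr (\<beta> - \<alpha> - 1) * (t * Beta \<beta> (1 - \<alpha>))) {0..t}"
    by (rule has_integral_mult_right)
  also have "\<beta> * t powr (\<beta> - \<alpha> - 1) * (t * Beta \<beta> (1 - \<alpha>)) = \<beta> * t powr (\<beta> - \<alpha>) * Beta \<beta> (1 - \<alpha>)"
    using t powr_mult_self[of t "\<beta> - \<alpha>" "\<beta> - \<alpha> - 1"] by simp
  \<comment> \<open>The endpoints are exempted: \<open>deriv y\<close> is known only for positive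
    arguments, and the kernel degenerates at \<open>t\<close>.\<close>
  finally have "((\<lambda>x. deriv y x / (t - x) powr \<alpha>) has_integral \<beta> * t powr (\<beta> - \<alpha>) * Beta \<beta> (1 - \<alpha>)) {0..t}"
  proof (rule has_integral_spike_finite[of "{0, t}", rotated 2])
    fix x assume "x \<in> {0..t} - {0, t}"
    then have x: "0 < x" "x < t" by auto
    have xt1: "(x / t) powr (\<beta> - 1) = x powr (\<beta> - 1) / t powr (\<beta> - 1)"
      using x by (simp add: powr_divide)
    have xt2: "(1 - x / t) powr (- \<alpha>) = t powr \<alpha> / (t - x) powr \<alpha>"
    proof -
      have "1 - x / t = (t - x) / t" using t by (simp add: field_simps)
      then show ?thesis using x by (simp add: powr_divide powr_minus_divide)
    qed
    have xt3: "t powr (\<beta> - \<alpha> - 1) * t powr \<alpha> = t powr (\<beta> - 1)"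
      by (simp flip: powr_add)
    have "\<beta> * t powr (\<beta> - \<alpha> - 1) * ((x / t) powr (\<beta> - 1) * (1 - x / t) powr (- \<alpha>)) =
        \<beta> * x powr (\<beta> - 1) / (t - x) powr \<alpha> * (t powr (\<beta> - 1) / t powr (\<beta> - 1))"
    proof -
      have "\<beta> * A * (X / P * (T / D)) = \<beta> * X / D * (P / P)" if "A * T = P" for A X P T D
        by (simp add: mult_ac flip: that)
      then show ?thesis unfolding xt1 xt2 using xt3 by blast
    qed
    then show "deriv y x / (t - x) powr \<alpha> =
        \<beta> * t powr (\<beta> - \<alpha> - 1) * ((x / t) powr (\<beta> - 1) * (1 - x / t) powr (- \<alpha>))"
      using t deriv_powr_on_nonneg[OF y x(1)] by simp
  qed simp
  then have "caputo_deriv \<alpha> y t = \<beta> * t powr (\<beta> - \<alpha>) * Beta (1 - \<alpha>) \<beta> / Gamma (1 - \<alpha>)"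
    by (simp add: caputo_deriv_def integral_unique Beta_commute)
  also have "Gamma (1 - \<alpha>) = - \<alpha> * Gamma (- \<alpha>)"
  proof -
    have "- \<alpha> \<notin> \<int>\<^sub>\<le>\<^sub>0"
    proof
      assume "- \<alpha> \<in> \<int>\<^sub>\<le>\<^sub>0"
      then obtain k where "\<alpha> = real k" by (auto elim!: nonpos_Ints_cases')
      then show False using \<alpha> by simp
    qed
    then show ?thesis using Gamma_plus1[of "- \<alpha>"] by simp
  qed
  finally show ?thesis using \<alpha> by (simp add: field_simps)
qed

theorem claim5:
  fixes \<alpha> \<beta> t :: real and y :: "real \<Rightarrow> real" and h :: "nat \<Rightarrow> real"
  assumes "0 < \<alpha>" and "\<alpha> < 1" and "\<beta> > 0" and "t > 0"
    and y: "\<And>x. x \<ge> 0 \<Longrightarrow> y x = x powr \<beta>"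
    and h: "\<And>n. n \<ge> 2 \<Longrightarrow> h n = t / real n"
  shows "(\<lambda>n. 1 / (Gamma (- \<alpha>) * h n powr \<alpha>) *
              ((\<Sum>k=1..n-1. y (real (n - k) * h n) / real k powr (1 + \<alpha>))
                - zeta_real (1 + \<alpha>) * y t + zeta_real \<alpha> * deriv y t * h n)
            - (caputo_deriv \<alpha> y t
                + zeta_real (- \<beta>) / (Gamma (- \<alpha>) * t powr (1 + \<alpha>)) * h n powr (1 + \<beta>)))
         \<in> O(\<lambda>n. h n powr (2 - \<alpha>))"
proof -
  note \<alpha> = \<open>0 < \<alpha>\<close> \<open>\<alpha> < 1\<close> and \<beta> = \<open>\<beta> > 0\<close> and t = \<open>t > 0\<close>
  define B where "B = Beta (1 - \<alpha>) \<beta>"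
  define E where "E = (\<lambda>n. (\<Sum>k=1..<n. (1 - real k / real n) powr \<beta> / real k powr (1 + \<alpha>))
      - zeta_real (1 + \<alpha>) + \<beta> * zeta_real \<alpha> / real n
      + \<beta> / \<alpha> * B * real n powr (- \<alpha>)
      - zeta_real (- \<beta>) * real n powr (- \<alpha> - 1 - \<beta>))"
  obtain C where C: "\<And>n. n \<ge> 1 \<Longrightarrow> \<bar>E n\<bar> \<le> C * real n powr (- 2)"
    unfolding E_def B_def using convolution_sum_asymp[OF \<alpha> \<beta>] by blast
  \<comment> \<open>What is left of
    \<open>t powr \<beta> / (Gamma (- \<alpha>) * h n powr \<alpha>)\<close> after removing
    \<open>n powr \<alpha>\<close>.\<close>
  define c where "c = t powr (\<beta> - \<alpha>) / Gamma (- \<alpha>)"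
  define F where "F = (\<lambda>n. 1 / (Gamma (- \<alpha>) * h n powr \<alpha>) *
              ((\<Sum>k=1..n-1. y (real (n - k) * h n) / real k powr (1 + \<alpha>))
                - zeta_real (1 + \<alpha>) * y t + zeta_real \<alpha> * deriv y t * h n)
            - (caputo_deriv \<alpha> y t
                + zeta_real (- \<beta>) / (Gamma (- \<alpha>) * t powr (1 + \<alpha>)) * h n powr (1 + \<beta>)))"
  \<comment> \<open>An exact identity: the Caputo and \<open>zeta_real (- \<beta>)\<close> terms are
    the corresponding terms of \<open>E\<close> times \<open>c * n powr \<alpha>\<close>.\<close>
  have F: "F n = c * real n powr \<alpha> * E n" if n: "n \<ge> 2" for n
  proof -
    define N where "N = real n powr \<alpha>"
    define S where "S = (\<Sum>k=1..<n. (1 - real k / real n) powr \<beta> / real k powr (1 + \<alpha>))"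
    have n0: "real n > 0" using n by simp
    have "y (real (n - k) * h n) / real k powr (1 + \<alpha>) =
        t powr \<beta> * ((1 - real k / real n) powr \<beta> / real k powr (1 + \<alpha>))" if "k \<in> {1..<n}" for k
    proof -
      have "real (n - k) * h n = t * (1 - real k / real n)"
        using h[OF n] n0 that by (simp add: of_nat_diff field_simps)
      moreover have "real k / real n \<le> 1" using that by simp
      ultimately show ?thesis using y t by (simp add: powr_mult)
    qed
    then have "(\<Sum>k=1..<n. y (real (n - k) * h n) / real k powr (1 + \<alpha>)) = t powr \<beta> * S"
      unfolding S_def sum_distrib_left by (rule sum.cong[OF refl])
    moreover have "{1..n-1} = {1..<n}" using n by auto
    moreover have "deriv y t * h n = t powr \<beta> * \<beta> / real n"
      using deriv_powr_on_nonneg[OF y t] h[OF n] t powr_mult_self[of t \<beta> "\<beta> - 1"] by simp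
    ultimately have main: "(\<Sum>k=1..n-1. y (real (n - k) * h n) / real k powr (1 + \<alpha>))
                - zeta_real (1 + \<alpha>) * y t + zeta_real \<alpha> * deriv y t * h n =
        t powr \<beta> * (S - zeta_real (1 + \<alpha>) + \<beta> * zeta_real \<alpha> / real n)"
      using y[of t] t by (simp add: algebra_simps)
    have "1 / (Gamma (- \<alpha>) * h n powr \<alpha>) * t powr \<beta> = c * N"
      unfolding c_def N_def h[OF n] using t n0 by (simp add: powr_divide powr_diff mult.commute)
    then have 1: "1 / (Gamma (- \<alpha>) * h n powr \<alpha>) *
              ((\<Sum>k=1..n-1. y (real (n - k) * h n) / real k powr (1 + \<alpha>))
                - zeta_real (1 + \<alpha>) * y t + zeta_real \<alpha> * deriv y t * h n) =
        c * N * (S - zeta_real (1 + \<alpha>) + \<beta> * zeta_real \<alpha> / real n)"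
      unfolding main by (simp only: mult.assoc[symmetric])
    have "N * real n powr (- \<alpha>) = 1"
      unfolding N_def using n0 by (simp flip: powr_add)
    then have 2: "caputo_deriv \<alpha> y t = - (c * N * (\<beta> / \<alpha> * B * real n powr (- \<alpha>)))"
    proof -
      have "caputo_deriv \<alpha> y t = - (\<beta> / \<alpha>) * B * t powr (\<beta> - \<alpha>) / Gamma (- \<alpha>)"
        unfolding B_def using \<alpha> \<beta> t y by (rule caputo_deriv_powr)
      also have "\<dots> = - (c * (\<beta> / \<alpha> * B) * (N * real n powr (- \<alpha>)))"
        unfolding \<open>N * real n powr (- \<alpha>) = 1\<close> c_def by (simp add: mult_ac)
      finally show ?thesis by (simp only: mult_ac)
    qed
    have "h n powr (1 + \<beta>) / t powr (1 + \<alpha>) = t powr (\<beta> - \<alpha>) * (N * real n powr (- \<alpha> - 1 - \<beta>))"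
    proof -
      have N: "N * real n powr (- \<alpha> - 1 - \<beta>) = 1 / real n powr (1 + \<beta>)"
        unfolding N_def powr_add[symmetric] powr_minus_divide[symmetric]
        by (rule arg_cong[of _ _ "(powr) (real n)"]) simp
      have "t powr (\<beta> - \<alpha>) = t powr (1 + \<beta>) / t powr (1 + \<alpha>)"
        unfolding powr_diff[symmetric] by simp
      then show ?thesis
        unfolding h[OF n] N using t n0 by (simp add: powr_divide mult.commute)
    qed
    moreover have "zeta_real (- \<beta>) / (Gamma (- \<alpha>) * t powr (1 + \<alpha>)) * h n powr (1 + \<beta>) =
        zeta_real (- \<beta>) / Gamma (- \<alpha>) * (h n powr (1 + \<beta>) / t powr (1 + \<alpha>))"
      by simp
    ultimately have 3: "zeta_real (- \<beta>) / (Gamma (- \<alpha>) * t powr (1 + \<alpha>)) * h n powr (1 + \<beta>) =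
        c * N * (zeta_real (- \<beta>) * real n powr (- \<alpha> - 1 - \<beta>))"
      by (simp add: c_def mult_ac)
    show ?thesis
      unfolding F_def 1 2 3 E_def S_def[symmetric] N_def[symmetric] by (simp add: algebra_simps)
  qed
  have "F \<in> O(\<lambda>n. h n powr (2 - \<alpha>))"
  \<comment> \<open>Since \<open>E n\<close> is of order \<open>n powr (- 2)\<close>, the product
    has order \<open>n powr (- (2 - \<alpha>))\<close>; the factor
    \<open>t powr (2 - \<alpha>)\<close> converts this to a power of \<open>h n\<close>.\<close>
  proof (rule bigoI[of _ "\<bar>c\<bar> * C / t powr (2 - \<alpha>)"])
    show "\<forall>\<^sub>F n in sequentially. norm (F n) \<le> \<bar>c\<bar> * C / t powr (2 - \<alpha>) * norm (h n powr (2 - \<alpha>))"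
      using eventually_ge_at_top[of 2]
    proof eventually_elim
      case (elim n)
      have "norm (F n) = \<bar>c\<bar> * real n powr \<alpha> * \<bar>E n\<bar>"
        unfolding F[OF elim] by (simp add: abs_mult)
      also have "\<dots> \<le> \<bar>c\<bar> * real n powr \<alpha> * (C * real n powr (- 2))"
        using C[of n] elim by (intro mult_left_mono) auto
      also have "\<dots> = \<bar>c\<bar> * C * (real n powr \<alpha> * real n powr (- 2))" by simp
      also have "real n powr \<alpha> * real n powr (- 2) = real n powr (- (2 - \<alpha>))"
        unfolding powr_add[symmetric] by simp
      also have "\<bar>c\<bar> * C * real n powr (- (2 - \<alpha>)) =
          \<bar>c\<bar> * C / t powr (2 - \<alpha>) * norm (h n powr (2 - \<alpha>))"
        unfolding h[OF elim] powr_minus_divide using t elim by (simp add: powr_divide)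
      finally show ?case .
    qed
  qed
  then show ?thesis unfolding F_def .
qed

end
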